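(* Let $\Sigma_L=(M,L,Fe)$ be a Lagrangian mechanical system and let $$S=y^i\frac{\partial}{\partial x^i}-2G^i(x,y)\frac{\partial}{\partial y^i},\qquad 2G^i=2\mathring G^i-\frac12F^i .$$ Then the following properties hold: 1. The semispray $S$ is given by $S=\mathring S+\frac12Fe$, where $\mathring S=y^i\frac{\partial}{\partial x^i}-2\mathring G^i\frac{\partial}{\partial y^i}$ is the canonical semispray of the Lagrange space $L^n=(M,L)$. 2. $S$ is a dynamical system on the velocity space $\widetilde{TM}$, that is, a globally defined vector field on $\widetilde{TM}$ with $JS=\mathbb C$. 3. The integral curves of $S$ are the evolution curves of $\Sigma_L$, that is, they are the curves $(x(t),y(t))$ with $y^i=\frac{dx^i}{dt}$ and $$\frac{d^2x^i}{dt^2}+2\mathring G^i\left(x,\frac{dx}{dt}\right)=\frac12F^i\left(x,\frac{dx}{dt}\right).$$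
   Context: The summation convention is used. $M$ is a real $n$-dimensional smooth manifold, $(x^i,y^i)$ are the induced coordinates on $TM$, and $\widetilde{TM}$ is $TM$ with the zero section removed. A Lagrange space $L^n=(M,L)$ is given by a function $L:TM\to\mathbb R$, smooth on $\widetilde{TM}$ and continuous on the zero section, such that $g_{ij}=\frac12\frac{\partial^2L}{\partial y^i\partial y^j}$ is nonsingular and of constant signature on $\widetilde{TM}$; $(g^{ij})$ is the inverse matrix, and $2\mathring G^i=\frac12g^{is}\left(\frac{\partial^2L}{\partial y^s\partial x^h}y^h-\frac{\partial L}{\partial x^s}\right)$. A Lagrangian mechanical system is a triple $\Sigma_L=(M,L,Fe)$ with $(M,L)$ a Lagrange space and $Fe=F^i(x,y)\frac{\partial}{\partial y^i}$ a given vertical vector field on $TM$ (external forces), with $F_i=g_{ij}F^j$. Its evolution equations are the Lagrange equations $\frac{d}{dt}\frac{\partial L}{\partial y^i}-\frac{\partial L}{\partial x^i}=F_i(x,y)$, $y^i=\frac{dx^i}{dt}$, which are equivalent to the second order system displayed in item 3; the solutions are the evolution curves. $J=\frac{\partial}{\partial y^i}\otimes dx^i$ is the tangent structure and $\mathbb C=y^i\frac{\partial}{\partial y^i}$ the Liouville vector field; a semispray is a vector field $S$ with $JS=\mathbb C$. *)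

theory Defs
  imports "HOL-Analysis.Analysis"
begin

section \<open>Smooth maps between Euclidean spaces\<close>

text \<open>Only meant for open sets \<open>S\<close>.\<close>

primrec Ck_on :: "nat \<Rightarrow> ('a::euclidean_space \<Rightarrow> 'b::real_normed_vector) \<Rightarrow> 'a set \<Rightarrow> bool" where
  "Ck_on 0 f S \<longleftrightarrow> continuous_on S f"
| "Ck_on (Suc k) f S \<longleftrightarrow>
     (\<forall>x\<in>S. f differentiable (at x)) \<and> (\<forall>v. Ck_on k (\<lambda>x. frechet_derivative f (at x) v) S)"

definition smooth_on :: "'a set \<Rightarrow> ('a::euclidean_space \<Rightarrow> 'b::real_normed_vector) \<Rightarrow> bool" where
  "smooth_on S f \<longleftrightarrow> (\<forall>k. Ck_on k f S)"


section \<open>Smooth manifolds\<close>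

text \<open>A chart is a domain together with a coordinate map, whose values off the domain are
  irrelevant. The model space is an arbitrary Euclidean space, so that the same notions serve for
  a manifold modelled on \<open>real ^ 'n\<close> and for its tangent bundle, modelled on
  \<open>(real ^ 'n) \<times> (real ^ 'n)\<close>. A manifold is represented by an atlas (not necessarily maximal).\<close>

type_synonym ('a, 'e) chart = "'a set \<times> ('a \<Rightarrow> 'e)"

definition chart_dom :: "('a, 'e) chart \<Rightarrow> 'a set" where
  "chart_dom c = fst c"

definition chart_map :: "('a, 'e) chart \<Rightarrow> 'a \<Rightarrow> 'e" where
  "chart_map c = snd c"

definition chart_inv :: "('a, 'e) chart \<Rightarrow> 'e \<Rightarrow> 'a" where
  "chart_inv c = inv_into (chart_dom c) (chart_map c)"

definition transition :: "('a, 'e) chart \<Rightarrow> ('a, 'e) chart \<Rightarrow> 'e \<Rightarrow> 'e" where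
  "transition c d = chart_map d \<circ> chart_inv c"

definition carrier_of :: "('a, 'e) chart set \<Rightarrow> 'a set" where
  "carrier_of A = (\<Union>c\<in>A. chart_dom c)"

definition smooth_atlas :: "('a, 'e::euclidean_space) chart set \<Rightarrow> bool" where
  "smooth_atlas A \<longleftrightarrow>
     (\<forall>c\<in>A. inj_on (chart_map c) (chart_dom c) \<and> open (chart_map c ` chart_dom c)) \<and>
     (\<forall>c\<in>A. \<forall>d\<in>A. open (chart_map c ` (chart_dom c \<inter> chart_dom d)) \<and>
        smooth_on (chart_map c ` (chart_dom c \<inter> chart_dom d)) (transition c d))"

text \<open>The topology making every chart of a smooth atlas a homeomorphism from an open set onto
  its image.\<close>

definition atlas_topology :: "('a, 'e::euclidean_space) chart set \<Rightarrow> 'a topology" where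
  "atlas_topology A = topology (\<lambda>W. W \<subseteq> carrier_of A \<and>
     (\<forall>c\<in>A. open {x \<in> chart_map c ` chart_dom c. chart_inv c x \<in> W}))"

lemma openin_atlas_topology:
  "openin (atlas_topology A) W \<longleftrightarrow> W \<subseteq> carrier_of A \<and>
     (\<forall>c\<in>A. open {x \<in> chart_map c ` chart_dom c. chart_inv c x \<in> W})"
proof -
  let ?P = "\<lambda>W. W \<subseteq> carrier_of A \<and>
     (\<forall>c\<in>A. open {x \<in> chart_map c ` chart_dom c. chart_inv c x \<in> W})"
  have "istopology ?P"
    unfolding istopology_def
  proof (intro conjI allI impI ballI)
    fix S T c assume S: "?P S" and T: "?P T" and "c \<in> A"
    then have "open ({x \<in> chart_map c ` chart_dom c. chart_inv c x \<in> S} \<inter>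
                     {x \<in> chart_map c ` chart_dom c. chart_inv c x \<in> T})"
      by blast
    moreover have "\<dots> = {x \<in> chart_map c ` chart_dom c. chart_inv c x \<in> S \<inter> T}"
      by blast
    ultimately show "open {x \<in> chart_map c ` chart_dom c. chart_inv c x \<in> S \<inter> T}"
      by simp
  next
    fix K c assume K: "\<forall>S\<in>K. ?P S" and "c \<in> A"
    then have "open (\<Union>S\<in>K. {x \<in> chart_map c ` chart_dom c. chart_inv c x \<in> S})"
      by blast
    moreover have "\<dots> = {x \<in> chart_map c ` chart_dom c. chart_inv c x \<in> \<Union>K}"
      by blast
    ultimately show "open {x \<in> chart_map c ` chart_dom c. chart_inv c x \<in> \<Union>K}"
      by simp
  qed blast+
  then show ?thesis
    unfolding atlas_topology_def by simp
qed

definition smooth_manifold :: "('a, 'e::euclidean_space) chart set \<Rightarrow> bool" where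
  "smooth_manifold A \<longleftrightarrow> smooth_atlas A \<and>
     Hausdorff_space (atlas_topology A) \<and> second_countable (atlas_topology A)"

definition smooth_fun_on ::
  "('a, 'e::euclidean_space) chart set \<Rightarrow> 'a set \<Rightarrow> ('a \<Rightarrow> 'b::real_normed_vector) \<Rightarrow> bool" where
  "smooth_fun_on A W f \<longleftrightarrow>
     (\<forall>c\<in>A. smooth_on (chart_map c ` (chart_dom c \<inter> W)) (f \<circ> chart_inv c))"


section \<open>Tangent vectors, vector fields, integral curves\<close>

text \<open>A tangent vector at \<open>p\<close> is the family of its components in the charts around \<open>p\<close>; the
  components in any two charts are related by the derivative of the transition map. The value \<open>0\<close>
  at charts not containing \<open>p\<close> is a convention making the representation unique and closed under
  the pointwise linear operations.\<close>

type_synonym ('a, 'e) tvec = "('a, 'e) chart \<Rightarrow> 'e"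

definition tangent_space ::
  "('a, 'e::euclidean_space) chart set \<Rightarrow> 'a \<Rightarrow> ('a, 'e) tvec set" where
  "tangent_space A p = {v.
     (\<forall>c. \<not> (c \<in> A \<and> p \<in> chart_dom c) \<longrightarrow> v c = 0) \<and>
     (\<forall>c\<in>A. \<forall>d\<in>A. p \<in> chart_dom c \<inter> chart_dom d \<longrightarrow>
        v d = frechet_derivative (transition c d) (at (chart_map c p)) (v c))}"

definition vector_field_on ::
  "('a, 'e::euclidean_space) chart set \<Rightarrow> 'a set \<Rightarrow> ('a \<Rightarrow> ('a, 'e) tvec) \<Rightarrow> bool" where
  "vector_field_on A W X \<longleftrightarrow>
     (\<forall>p\<in>W. X p \<in> tangent_space A p) \<and>
     (\<forall>c\<in>A. smooth_on (chart_map c ` (chart_dom c \<inter> W)) (\<lambda>x. X (chart_inv c x) c))"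

definition curve_in ::
  "('a, 'e::euclidean_space) chart set \<Rightarrow> 'a set \<Rightarrow> real set \<Rightarrow> (real \<Rightarrow> 'a) \<Rightarrow> bool" where
  "curve_in A W I \<gamma> \<longleftrightarrow>
     continuous_map (top_of_set I) (atlas_topology A) \<gamma> \<and> (\<forall>t\<in>I. \<gamma> t \<in> W)"

definition integral_curve ::
  "('a, 'e::euclidean_space) chart set \<Rightarrow> 'a set \<Rightarrow> ('a \<Rightarrow> ('a, 'e) tvec) \<Rightarrow>
   real set \<Rightarrow> (real \<Rightarrow> 'a) \<Rightarrow> bool" where
  "integral_curve A W X I \<gamma> \<longleftrightarrow> curve_in A W I \<gamma> \<and>
     (\<forall>c\<in>A. \<forall>t\<in>I. \<gamma> t \<in> chart_dom c \<longrightarrow>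
        ((\<lambda>s. chart_map c (\<gamma> s)) has_vector_derivative X (\<gamma> t) c) (at t))"


section \<open>The tangent bundle\<close>

text \<open>Every chart \<open>c = (x\<^sup>i)\<close> of \<open>M\<close> induces the chart \<open>(x\<^sup>i, y\<^sup>i)\<close> of \<open>TM\<close>.\<close>

type_synonym ('m, 'e) tpoint = "'m \<times> ('m, 'e) tvec"

type_synonym ('m, 'e) tfield = "('m, 'e) tpoint \<Rightarrow> (('m, 'e) tpoint, 'e \<times> 'e) tvec"

definition induced_chart ::
  "('m, 'e::euclidean_space) chart set \<Rightarrow> ('m, 'e) chart \<Rightarrow> (('m, 'e) tpoint, 'e \<times> 'e) chart" where
  "induced_chart A c =
     ({(p, v). p \<in> chart_dom c \<and> v \<in> tangent_space A p}, (\<lambda>(p, v). (chart_map c p, v c)))"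

definition tangent_atlas ::
  "('m, 'e::euclidean_space) chart set \<Rightarrow> (('m, 'e) tpoint, 'e \<times> 'e) chart set" where
  "tangent_atlas A = induced_chart A ` A"

definition TM :: "('m, 'e::euclidean_space) chart set \<Rightarrow> ('m, 'e) tpoint set" where
  "TM A = {(p, v). p \<in> carrier_of A \<and> v \<in> tangent_space A p}"

definition slit_TM :: "('m, 'e::euclidean_space) chart set \<Rightarrow> ('m, 'e) tpoint set" where
  "slit_TM A = {(p, v) \<in> TM A. v \<noteq> (\<lambda>c. 0)}"

text \<open>In the induced chart \<open>C\<close>, a tangent vector \<open>w\<close> to \<open>TM\<close> with \<open>w C = (a, b)\<close> is
  \<open>a\<^sup>i \<partial>/\<partial>x\<^sup>i + b\<^sup>i \<partial>/\<partial>y\<^sup>i\<close>.\<close>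

definition tangent_structure ::
  "(('m, 'e::euclidean_space) tpoint, 'e \<times> 'e) tvec \<Rightarrow> (('m, 'e) tpoint, 'e \<times> 'e) tvec" where
  "tangent_structure w = (\<lambda>C. (0, fst (w C)))"

definition liouville ::
  "('m, 'e::euclidean_space) chart set \<Rightarrow> ('m, 'e) tpoint \<Rightarrow> (('m, 'e) tpoint, 'e \<times> 'e) tvec" where
  "liouville A z = (\<lambda>C. if C \<in> tangent_atlas A \<and> z \<in> chart_dom C
     then (0, snd (chart_map C z)) else 0)"

definition vertical_field ::
  "('m, 'e::euclidean_space) chart set \<Rightarrow> ('m, 'e) tfield \<Rightarrow> bool" where
  "vertical_field A X \<longleftrightarrow> vector_field_on (tangent_atlas A) (TM A) X \<and>
     (\<forall>C\<in>tangent_atlas A. \<forall>z\<in>chart_dom C. fst (X z C) = 0)"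

definition semispray ::
  "('m, 'e::euclidean_space) chart set \<Rightarrow> ('m, 'e) tfield \<Rightarrow> bool" where
  "semispray A X \<longleftrightarrow> vector_field_on (tangent_atlas A) (slit_TM A) X \<and>
     (\<forall>z\<in>slit_TM A. tangent_structure (X z) = liouville A z)"


section \<open>Lagrange spaces\<close>

type_synonym 'n xy = "(real ^ 'n) \<times> (real ^ 'n)"

definition partial_x :: "'n::finite \<Rightarrow> ('n xy \<Rightarrow> real) \<Rightarrow> 'n xy \<Rightarrow> real" where
  "partial_x i f u = frechet_derivative f (at u) (axis i 1, 0)"

definition partial_y :: "'n::finite \<Rightarrow> ('n xy \<Rightarrow> real) \<Rightarrow> 'n xy \<Rightarrow> real" where
  "partial_y i f u = frechet_derivative f (at u) (0, axis i 1)"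

text \<open>From here on, \<open>C\<close> stands for an induced chart of \<open>TM\<close>, and \<open>u = (x, y)\<close> for the coordinates
  of a point of \<open>TM\<close> in \<open>C\<close>.\<close>

definition metric_matrix ::
  "('t \<Rightarrow> real) \<Rightarrow> ('t, 'n xy) chart \<Rightarrow> 'n xy \<Rightarrow> real ^ 'n ^ 'n::finite" where
  "metric_matrix L C u = (\<chi> i j. 1/2 * partial_y i (partial_y j (L \<circ> chart_inv C)) u)"

definition has_signature :: "real ^ 'n ^ 'n::finite \<Rightarrow> nat \<Rightarrow> nat \<Rightarrow> bool" where
  "has_signature Q p q \<longleftrightarrow> (\<exists>(P :: real ^ 'n ^ 'n) (d :: 'n \<Rightarrow> real). invertible P \<and>
     transpose P ** Q ** P = (\<chi> i j. if i = j then d i else 0) \<and>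
     card {i. d i > 0} = p \<and> card {i. d i < 0} = q)"

definition lagrange_space ::
  "('m, real ^ 'n::finite) chart set \<Rightarrow> (('m, real ^ 'n) tpoint \<Rightarrow> real) \<Rightarrow> bool" where
  "lagrange_space A L \<longleftrightarrow>
     smooth_manifold A \<and>
     smooth_fun_on (tangent_atlas A) (slit_TM A) L \<and>
     continuous_map (atlas_topology (tangent_atlas A)) euclideanreal L \<and>
     (\<forall>C\<in>tangent_atlas A. \<forall>z\<in>chart_dom C \<inter> slit_TM A.
        invertible (metric_matrix L C (chart_map C z))) \<and>
     (\<exists>p q. \<forall>C\<in>tangent_atlas A. \<forall>z\<in>chart_dom C \<inter> slit_TM A.
        has_signature (metric_matrix L C (chart_map C z)) p q)"

definition lagrangian_mechanical_system ::
  "('m, real ^ 'n::finite) chart set \<Rightarrow> (('m, real ^ 'n) tpoint \<Rightarrow> real) \<Rightarrow>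
   ('m, real ^ 'n) tfield \<Rightarrow> bool" where
  "lagrangian_mechanical_system A L Fe \<longleftrightarrow> lagrange_space A L \<and> vertical_field A Fe"

text \<open>The components \<open>F\<^sup>i\<close> and \<open>F\<^sub>i\<close> of the external forces.\<close>

definition force ::
  "('t \<Rightarrow> ('t, 'n xy) tvec) \<Rightarrow> ('t, 'n xy) chart \<Rightarrow> 'n xy \<Rightarrow> real ^ 'n::finite" where
  "force Fe C u = snd (Fe (chart_inv C u) C)"

definition lower_force ::
  "('t \<Rightarrow> real) \<Rightarrow> ('t \<Rightarrow> ('t, 'n xy) tvec) \<Rightarrow>
   ('t, 'n xy) chart \<Rightarrow> 'n xy \<Rightarrow> real ^ 'n::finite" where
  "lower_force L Fe C u = (\<chi> i. \<Sum>j\<in>UNIV. metric_matrix L C u $ i $ j * force Fe C u $ j)"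

text \<open>The coefficients \<open>2 G\<^sup>i\<close>, the factor 2 included, of the canonical semispray and of the
  semispray of the mechanical system.\<close>

definition two_G0 ::
  "('t \<Rightarrow> real) \<Rightarrow> ('t, 'n xy) chart \<Rightarrow> 'n xy \<Rightarrow> real ^ 'n::finite" where
  "two_G0 L C u = (\<chi> i. 1/2 * (\<Sum>s\<in>UNIV. matrix_inv (metric_matrix L C u) $ i $ s *
     ((\<Sum>h\<in>UNIV. partial_y s (partial_x h (L \<circ> chart_inv C)) u * snd u $ h)
        - partial_x s (L \<circ> chart_inv C) u)))"

definition two_G ::
  "('t \<Rightarrow> real) \<Rightarrow> ('t \<Rightarrow> ('t, 'n xy) tvec) \<Rightarrow>
   ('t, 'n xy) chart \<Rightarrow> 'n xy \<Rightarrow> real ^ 'n::finite" where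
  "two_G L Fe C u = two_G0 L C u - (1/2) *\<^sub>R force Fe C u"

text \<open>The family of local expressions \<open>y\<^sup>i \<partial>/\<partial>x\<^sup>i - H\<^sup>i \<partial>/\<partial>y\<^sup>i\<close>. That they fit together to a tangent
  vector is not part of the definition.\<close>

definition local_semispray ::
  "('m, real ^ 'n::finite) chart set \<Rightarrow>
   ((('m, real ^ 'n) tpoint, 'n xy) chart \<Rightarrow> 'n xy \<Rightarrow> real ^ 'n) \<Rightarrow>
   ('m, real ^ 'n) tfield" where
  "local_semispray A H z = (\<lambda>C. if C \<in> tangent_atlas A \<and> z \<in> chart_dom C
     then (snd (chart_map C z), - H C (chart_map C z)) else 0)"

definition canonical_semispray ::
  "('m, real ^ 'n::finite) chart set \<Rightarrow> (('m, real ^ 'n) tpoint \<Rightarrow> real) \<Rightarrow>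
   ('m, real ^ 'n) tfield" where
  "canonical_semispray A L = local_semispray A (two_G0 L)"

definition mechanical_semispray ::
  "('m, real ^ 'n::finite) chart set \<Rightarrow> (('m, real ^ 'n) tpoint \<Rightarrow> real) \<Rightarrow>
   ('m, real ^ 'n) tfield \<Rightarrow> ('m, real ^ 'n) tfield" where
  "mechanical_semispray A L Fe = local_semispray A (two_G L Fe)"


section \<open>Evolution curves\<close>

text \<open>Solutions \<open>\<gamma> = (x(t), y(t))\<close> of the Lagrange equations
  \<open>d/dt (\<partial>L/\<partial>y\<^sup>i) - \<partial>L/\<partial>x\<^sup>i = F\<^sub>i\<close>, \<open>y\<^sup>i = dx\<^sup>i/dt\<close>. As a solution of a second order equation,
  \<open>x\<close> is required to be twice differentiable. The curves stay in the slit tangent bundle, where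
  \<open>L\<close> is differentiable.\<close>

definition evolution_curve ::
  "('m, real ^ 'n::finite) chart set \<Rightarrow> (('m, real ^ 'n) tpoint \<Rightarrow> real) \<Rightarrow>
   ('m, real ^ 'n) tfield \<Rightarrow> real set \<Rightarrow> (real \<Rightarrow> ('m, real ^ 'n) tpoint) \<Rightarrow> bool" where
  "evolution_curve A L Fe I \<gamma> \<longleftrightarrow>
     curve_in (tangent_atlas A) (slit_TM A) I \<gamma> \<and>
     (\<forall>C\<in>tangent_atlas A. \<forall>t\<in>I. \<gamma> t \<in> chart_dom C \<longrightarrow>
        (let u = (\<lambda>s. chart_map C (\<gamma> s)); x = (\<lambda>s. fst (u s)); y = (\<lambda>s. snd (u s)) in
          (x has_vector_derivative y t) (at t) \<and>
          y differentiable (at t) \<and>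
          (\<forall>i. deriv (\<lambda>s. partial_y i (L \<circ> chart_inv C) (u s)) t
                 - partial_x i (L \<circ> chart_inv C) (u t) = lower_force L Fe C (u t) $ i)))"

text \<open>Curves \<open>(x(t), y(t))\<close> with \<open>y\<^sup>i = dx\<^sup>i/dt\<close> and
  \<open>d\<^sup>2x\<^sup>i/dt\<^sup>2 + 2 G0\<^sup>i(x, dx/dt) = 1/2 F\<^sup>i(x, dx/dt)\<close>.\<close>

definition second_order_solution ::
  "('m, real ^ 'n::finite) chart set \<Rightarrow> (('m, real ^ 'n) tpoint \<Rightarrow> real) \<Rightarrow>
   ('m, real ^ 'n) tfield \<Rightarrow> real set \<Rightarrow> (real \<Rightarrow> ('m, real ^ 'n) tpoint) \<Rightarrow> bool" where
  "second_order_solution A L Fe I \<gamma> \<longleftrightarrow>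
     curve_in (tangent_atlas A) (slit_TM A) I \<gamma> \<and>
     (\<forall>C\<in>tangent_atlas A. \<forall>t\<in>I. \<gamma> t \<in> chart_dom C \<longrightarrow>
        (let u = (\<lambda>s. chart_map C (\<gamma> s)); x = (\<lambda>s. fst (u s)); y = (\<lambda>s. snd (u s));
             x' = (\<lambda>s. vector_derivative x (at s)) in
          (x has_vector_derivative y t) (at t) \<and>
          (\<exists>a. (x' has_vector_derivative a) (at t) \<and>
               a + two_G0 L C (x t, x' t) = (1/2) *\<^sub>R force Fe C (x t, x' t))))"

end

theory Submission
  imports Defs
begin

text \<open>The whole statement is governed by one coordinate expression, the Lagrange covector of \<open>L\<close> at
  a point \<open>u = (x, y)\<close>, applied to \<open>w\<close>, for an acceleration \<open>b\<close>:
  \<open>E(b)(w) = D(u' \<mapsto> DL(u')(0, w))(u)(y, b) - DL(u)(w, 0)\<close>.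
  Along a curve with \<open>x' = y\<close> and \<open>y' = b\<close> its components are the left-hand sides of the Lagrange
  equations (\<open>lagrange_covector_along_curve\<close>). In coordinates it equals \<open>2 g (b + 2G0)\<close>, where
  \<open>2G0\<close> are the coefficients of the canonical semispray (\<open>lagrange_covector_axis\<close>). As \<open>g\<close> is
  nonsingular, two things follow: \<open>E(b) = 0\<close> characterizes \<open>b = - 2G0\<close>, and \<open>E(b)\<^sub>i = F\<^sub>i\<close>
  characterizes \<open>b = - 2G\<close>, so that the Lagrange equations say precisely that the curve is an integral
  curve of \<open>S\<close>.

  The canonical semispray is a globally defined vector field because the covector is natural: under
  the tangent map \<open>T (x, y) = (\<phi> x, D\<phi>(x) y)\<close> of a change of coordinates \<open>\<phi>\<close> of \<open>M\<close>, the covector of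
  \<open>L \<circ> T\<close> for \<open>b\<close> is the pullback by \<open>D\<phi>\<close> of the covector of \<open>L\<close> for the vertical part of
  \<open>DT (y, b)\<close> (\<open>lagrange_covector_natural\<close>). The two terms containing the second derivative of \<open>\<phi>\<close>
  cancel, by the symmetry of that derivative. Hence the unique zeros \<open>b = - 2G0\<close> of the covectors in
  two charts correspond to each other, and this is the transformation law of a tangent vector
  \<open>(y, - 2G0)\<close> to \<open>TM\<close>, the transition maps of the induced charts being tangent maps
  (\<open>chart_map_eq_tangent_map\<close>). Smoothness of \<open>2G0\<close> comes from Cramer's rule. Finally
  \<open>S\<close> is the canonical semispray plus half of the vertical field \<open>Fe\<close>, so it is a semispray too.

  The second order equation differs from the equation of an integral curve in one respect: it is
  written with the derivative of \<open>x\<close> in place of \<open>y\<close>. The two agree near each time, since a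
  curve that is in the domain of a chart at some time remains there for nearby times.\<close>

section \<open>Calculus of smooth functions\<close>

abbreviation Fd :: "('a::real_normed_vector \<Rightarrow> 'b::real_normed_vector) \<Rightarrow> 'a \<Rightarrow> 'a \<Rightarrow> 'b" where
  "Fd f x \<equiv> frechet_derivative f (at x)"

lemma Fd_eqI: "(f has_derivative f') (at x) \<Longrightarrow> Fd f x = f'"
  by (rule frechet_derivative_at[symmetric])

text \<open>The points of the open set are the only ones that matter: this locality is what lets the recursive
  definition of \<open>Ck_on\<close> be transported along equations that hold only on a chart image.\<close>

lemma Fd_cong_open:
  assumes "open S" "x \<in> S" "\<And>z. z \<in> S \<Longrightarrow> f z = g z"
  shows "f differentiable (at x) \<longleftrightarrow> g differentiable (at x)"
    and "Fd f x = Fd g x"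
proof -
  have eq: "(f has_derivative f') (at x) \<longleftrightarrow> (g has_derivative f') (at x)" for f'
    using assms by (auto intro: has_derivative_transform_within_open[of _ _ _ UNIV S])
  then show "f differentiable (at x) \<longleftrightarrow> g differentiable (at x)"
    by (simp add: differentiable_def)
  show "Fd f x = Fd g x"
    unfolding frechet_derivative_def by (simp add: eq)
qed

lemma Ck_on_subset: "Ck_on k f S \<Longrightarrow> T \<subseteq> S \<Longrightarrow> Ck_on k f T"
  by (induction k arbitrary: f) (auto intro: continuous_on_subset)

lemma Ck_on_cong:
  assumes "open S"
  shows "Ck_on k f S \<Longrightarrow> (\<And>x. x \<in> S \<Longrightarrow> f x = g x) \<Longrightarrow> Ck_on k g S"
proof (induction k arbitrary: f g)
  case 0
  then show ?case by (auto cong: continuous_on_cong)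
next
  case (Suc k)
  have "g differentiable (at x)" "Fd f x = Fd g x" if "x \<in> S" for x
    using Fd_cong_open[OF assms that Suc.prems(2)] Suc.prems(1) that by auto
  then show ?case
    using Suc.prems(1) by (auto intro: Suc.IH)
qed

lemma Ck_on_lower: "Ck_on (Suc k) f S \<Longrightarrow> Ck_on k f S"
proof (induction k arbitrary: f)
  case 0
  then show ?case
    by (auto intro!: continuous_at_imp_continuous_on differentiable_imp_continuous_within)
qed auto

lemma Ck_on_bounded_linear:
  assumes h: "bounded_linear h" and S: "open S"
  shows "Ck_on k f S \<Longrightarrow> Ck_on k (\<lambda>x. h (f x)) S"
proof (induction k arbitrary: f)
  case 0
  then show ?case by (simp add: bounded_linear.continuous_on[OF h])
next
  case (Suc k)
  have d: "((\<lambda>x. h (f x)) has_derivative (\<lambda>v. h (Fd f x v))) (at x)" if "x \<in> S" for x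
    using Suc.prems that
    by (auto intro!: bounded_linear.has_derivative[OF h] simp: frechet_derivative_works[symmetric])
  have "Ck_on k (\<lambda>x. Fd (\<lambda>x. h (f x)) x v) S" for v
    by (rule Ck_on_cong[OF S Suc.IH[of "\<lambda>x. Fd f x v"]])
      (use Suc.prems in \<open>auto simp: Fd_eqI[OF d]\<close>)
  with d show ?case by (auto simp: differentiable_def)
qed

lemma Ck_on_add:
  assumes S: "open S"
  shows "Ck_on k f S \<Longrightarrow> Ck_on k g S \<Longrightarrow> Ck_on k (\<lambda>x. f x + g x) S"
proof (induction k arbitrary: f g)
  case 0
  then show ?case by (simp add: continuous_on_add)
next
  case (Suc k)
  have d: "((\<lambda>x. f x + g x) has_derivative (\<lambda>v. Fd f x v + Fd g x v)) (at x)" if "x \<in> S" for x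
    using Suc.prems that
    by (auto intro!: has_derivative_add simp: frechet_derivative_works[symmetric])
  have "Ck_on k (\<lambda>x. Fd (\<lambda>x. f x + g x) x v) S" for v
    by (rule Ck_on_cong[OF S Suc.IH[of "\<lambda>x. Fd f x v" "\<lambda>x. Fd g x v"]])
      (use Suc.prems in \<open>auto simp: Fd_eqI[OF d]\<close>)
  with d show ?case by (auto simp: differentiable_def)
qed

lemma Ck_on_const: "Ck_on k (\<lambda>x. c) S"
  by (induction k arbitrary: c) auto

lemma Ck_on_linear:
  assumes h: "bounded_linear h"
  shows "Ck_on k h S"
proof (cases k)
  case 0
  then show ?thesis using bounded_linear.continuous_on[OF h continuous_on_id] by simp
next
  case (Suc l)
  have d: "(h has_derivative h) (at x)" for x
    using bounded_linear_imp_has_derivative[OF h] .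
  then show ?thesis
    using Suc by (auto simp: Fd_eqI[OF d] Ck_on_const differentiable_def)
qed

text \<open>The derivative of a product is a sum of products of factors of class \<open>C\<^sup>k\<close>, of which one may be an
  original factor; that factor has one derivative to spare, which \<open>Ck_on_lower\<close> gives away. The induction
  hypothesis has to cover all pairs of factors for this reason.\<close>

lemma Ck_on_mult:
  fixes f g :: "'a::euclidean_space \<Rightarrow> real"
  assumes S: "open S"
  shows "Ck_on k f S \<Longrightarrow> Ck_on k g S \<Longrightarrow> Ck_on k (\<lambda>x. f x * g x) S"
proof (induction k arbitrary: f g)
  case 0
  then show ?case by (simp add: continuous_on_mult)
next
  case (Suc k)
  have d: "((\<lambda>x. f x * g x) has_derivative (\<lambda>v. f x * Fd g x v + Fd f x v * g x)) (at x)"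
    if "x \<in> S" for x
    using Suc.prems that
    by (auto intro!: has_derivative_mult simp: frechet_derivative_works[symmetric])
  have "Ck_on k (\<lambda>x. f x * Fd g x v + Fd f x v * g x) S" for v
    using Suc.prems Ck_on_lower[OF Suc.prems(1)] Ck_on_lower[OF Suc.prems(2)]
    by (intro Ck_on_add[OF S] Suc.IH) auto
  then have "Ck_on k (\<lambda>x. Fd (\<lambda>x. f x * g x) x v) S" for v
    by (rule Ck_on_cong[OF S]) (auto simp: Fd_eqI[OF d])
  with d show ?case by (auto simp: differentiable_def)
qed

lemma Ck_on_inverse:
  fixes f :: "'a::euclidean_space \<Rightarrow> real"
  assumes S: "open S"
  shows "Ck_on k f S \<Longrightarrow> (\<And>x. x \<in> S \<Longrightarrow> f x \<noteq> 0) \<Longrightarrow> Ck_on k (\<lambda>x. inverse (f x)) S"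
proof (induction k arbitrary: f)
  case 0
  then show ?case by (auto intro: continuous_on_inverse)
next
  case (Suc k)
  have d: "((\<lambda>x. inverse (f x)) has_derivative
      (\<lambda>v. (- 1) * (inverse (f x) * Fd f x v * inverse (f x)))) (at x)"
    if "x \<in> S" for x
    using Suc.prems that
    by (auto intro!: derivative_eq_intros simp: frechet_derivative_works[symmetric])
  have "Ck_on k (\<lambda>x. (- 1) * (inverse (f x) * Fd f x v * inverse (f x))) S" for v
    using Suc.prems Ck_on_lower[OF Suc.prems(1)]
    by (intro Ck_on_mult[OF S] Suc.IH Ck_on_const) auto
  then have "Ck_on k (\<lambda>x. Fd (\<lambda>x. inverse (f x)) x v) S" for v
    by (rule Ck_on_cong[OF S]) (auto simp: Fd_eqI[OF d])
  with d show ?case by (auto simp: differentiable_def)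
qed

lemma smooth_on_subset: "smooth_on S f \<Longrightarrow> T \<subseteq> S \<Longrightarrow> smooth_on T f"
  unfolding smooth_on_def by (blast intro: Ck_on_subset)

lemma smooth_on_cong:
  "open S \<Longrightarrow> smooth_on S f \<Longrightarrow> (\<And>x. x \<in> S \<Longrightarrow> f x = g x) \<Longrightarrow> smooth_on S g"
  unfolding smooth_on_def by (blast intro: Ck_on_cong)

lemma smooth_on_continuous: "smooth_on S f \<Longrightarrow> continuous_on S f"
  unfolding smooth_on_def by (metis Ck_on.simps(1))

lemma smooth_on_differentiable: "smooth_on S f \<Longrightarrow> x \<in> S \<Longrightarrow> f differentiable (at x)"
  unfolding smooth_on_def by (metis Ck_on.simps(2))

lemma smooth_on_has_derivative: "smooth_on S f \<Longrightarrow> x \<in> S \<Longrightarrow> (f has_derivative Fd f x) (at x)"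
  using smooth_on_differentiable frechet_derivative_works by blast

lemma linear_Fd: "smooth_on S f \<Longrightarrow> x \<in> S \<Longrightarrow> linear (Fd f x)"
  using linear_frechet_derivative smooth_on_differentiable by blast

lemma smooth_on_Fd: "smooth_on S f \<Longrightarrow> smooth_on S (\<lambda>x. Fd f x v)"
  unfolding smooth_on_def by (metis Ck_on.simps(2))

lemma smooth_on_bounded_linear:
  "bounded_linear h \<Longrightarrow> open S \<Longrightarrow> smooth_on S f \<Longrightarrow> smooth_on S (\<lambda>x. h (f x))"
  unfolding smooth_on_def by (blast intro: Ck_on_bounded_linear)

lemma smooth_on_linear: "bounded_linear h \<Longrightarrow> smooth_on S h"
  unfolding smooth_on_def by (blast intro: Ck_on_linear)

lemma smooth_on_const: "smooth_on S (\<lambda>x. c)"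
  unfolding smooth_on_def by (blast intro: Ck_on_const)

lemma smooth_on_add:
  "open S \<Longrightarrow> smooth_on S f \<Longrightarrow> smooth_on S g \<Longrightarrow> smooth_on S (\<lambda>x. f x + g x)"
  unfolding smooth_on_def by (blast intro: Ck_on_add)

lemma smooth_on_scaleR: "open S \<Longrightarrow> smooth_on S f \<Longrightarrow> smooth_on S (\<lambda>x. c *\<^sub>R f x)"
  by (rule smooth_on_bounded_linear[OF bounded_linear_scaleR_right])

lemma smooth_on_diff:
  assumes "open S" "smooth_on S f" "smooth_on S g"
  shows "smooth_on S (\<lambda>x. f x - g x)"
  using smooth_on_add[OF assms(1,2) smooth_on_scaleR[OF assms(1,3), of "- 1"]] by simp

lemma smooth_on_sum:
  assumes "open S" "\<And>i. i \<in> I \<Longrightarrow> smooth_on S (f i)"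
  shows "smooth_on S (\<lambda>x. \<Sum>i\<in>I. f i x)"
  using assms(2)
  by (induction I rule: infinite_finite_induct) (auto intro: smooth_on_const smooth_on_add[OF assms(1)])

lemma smooth_on_mult:
  fixes f g :: "'a::euclidean_space \<Rightarrow> real"
  shows "open S \<Longrightarrow> smooth_on S f \<Longrightarrow> smooth_on S g \<Longrightarrow> smooth_on S (\<lambda>x. f x * g x)"
  unfolding smooth_on_def by (blast intro: Ck_on_mult)

lemma smooth_on_prod:
  fixes f :: "'i \<Rightarrow> 'a::euclidean_space \<Rightarrow> real"
  assumes "open S" "\<And>i. i \<in> I \<Longrightarrow> smooth_on S (f i)"
  shows "smooth_on S (\<lambda>x. \<Prod>i\<in>I. f i x)"
  using assms(2)
  by (induction I rule: infinite_finite_induct) (auto intro: smooth_on_const smooth_on_mult[OF assms(1)])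

lemma smooth_on_divide:
  fixes f g :: "'a::euclidean_space \<Rightarrow> real"
  assumes "open S" "smooth_on S f" "smooth_on S g" "\<And>x. x \<in> S \<Longrightarrow> g x \<noteq> 0"
  shows "smooth_on S (\<lambda>x. f x / g x)"
proof -
  have "smooth_on S (\<lambda>x. inverse (g x))"
    using assms unfolding smooth_on_def by (blast intro: Ck_on_inverse)
  then show ?thesis
    unfolding divide_inverse by (intro smooth_on_mult assms)
qed

lemma smooth_on_Pair:
  assumes S: "open S" and f: "smooth_on S f" and g: "smooth_on S g"
  shows "smooth_on S (\<lambda>x. (f x, g x))"
proof -
  have "bounded_linear (\<lambda>y. (y, 0))" "bounded_linear (\<lambda>z. (0, z))"
    by (auto intro!: bounded_linear_Pair bounded_linear_ident bounded_linear_zero)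
  from smooth_on_add[OF S smooth_on_bounded_linear[OF this(1) S f] smooth_on_bounded_linear[OF this(2) S g]]
  show ?thesis by simp
qed

lemma smooth_on_vec:
  fixes f :: "'a::euclidean_space \<Rightarrow> real ^ 'n::finite"
  assumes S: "open S" and f: "\<And>i. smooth_on S (\<lambda>x. f x $ i)"
  shows "smooth_on S f"
proof -
  have "smooth_on S (\<lambda>x. \<Sum>i\<in>UNIV. f x $ i *\<^sub>R axis i (1::real))"
    by (intro smooth_on_sum S smooth_on_bounded_linear[OF bounded_linear_scaleR_left] f)
  moreover have "(\<Sum>i\<in>UNIV. f x $ i *\<^sub>R axis i (1::real)) = f x" for x
    by (auto simp: vec_eq_iff axis_def if_distrib cong: if_cong)
  ultimately show ?thesis by simp
qed

lemma smooth_on_det: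
  fixes B :: "'a::euclidean_space \<Rightarrow> real ^ 'n ^ 'n::finite"
  assumes "open S" "\<And>i j. smooth_on S (\<lambda>x. B x $ i $ j)"
  shows "smooth_on S (\<lambda>x. det (B x))"
  unfolding det_def
  by (intro smooth_on_sum smooth_on_mult smooth_on_prod smooth_on_const assms)

lemma matrix_inv_mult_eq_iff:
  fixes B :: "real ^ 'n ^ 'n::finite"
  assumes "invertible B"
  shows "matrix_inv B *v r = z \<longleftrightarrow> B *v z = r"
proof
  have 1: "B ** matrix_inv B = mat 1" "matrix_inv B ** B = mat 1"
    using someI_ex[OF assms[unfolded invertible_def]] unfolding matrix_inv_def by auto
  show "matrix_inv B *v r = z \<Longrightarrow> B *v z = r"
    using 1 by (auto simp: matrix_vector_mul_assoc)
  show "B *v z = r \<Longrightarrow> matrix_inv B *v r = z"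
    using 1 by (auto simp: matrix_vector_mul_assoc)
qed

text \<open>Cramer's rule writes the solution of a linear system as a quotient of determinants, which are
  polynomials in the entries.\<close>

lemma smooth_on_matrix_inv_mult:
  fixes B :: "'a::euclidean_space \<Rightarrow> real ^ 'n ^ 'n::finite"
  assumes S: "open S" and B: "\<And>i j. smooth_on S (\<lambda>x. B x $ i $ j)"
    and r: "\<And>i. smooth_on S (\<lambda>x. r x $ i)"
    and inv: "\<And>x. x \<in> S \<Longrightarrow> invertible (B x)"
  shows "smooth_on S (\<lambda>x. matrix_inv (B x) *v r x)"
proof -
  let ?z = "\<lambda>x. \<chi> k. det (\<chi> i j. if j = k then r x $ i else B x $ i $ j) / det (B x)"
  have "smooth_on S ?z"
  proof (rule smooth_on_vec[OF S])
    fix k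
    have "smooth_on S (\<lambda>x. (\<chi> i j. if j = k then r x $ i else B x $ i $ j) $ i $ j)" for i j
      using B r by (cases "j = k") auto
    then show "smooth_on S (\<lambda>x. ?z x $ k)"
      using inv by (auto intro!: smooth_on_divide S smooth_on_det B simp: invertible_det_nz)
  qed
  then show ?thesis
  proof (rule smooth_on_cong[OF S])
    fix x assume "x \<in> S"
    then have "B x *v ?z x = r x"
      using inv cramer[of "B x" "?z x" "r x"] by (simp add: invertible_det_nz)
    then show "?z x = matrix_inv (B x) *v r x"
      by (rule matrix_inv_mult_eq_iff[OF inv[OF \<open>x \<in> S\<close>], THEN iffD2, symmetric])
  qed
qed

section \<open>Symmetry of the second derivative\<close>

lemma has_field_derivative_along_line:
  fixes f :: "'a::euclidean_space \<Rightarrow> real"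
  assumes "f differentiable (at (x + s *\<^sub>R v))"
  shows "((\<lambda>s. f (x + s *\<^sub>R v)) has_field_derivative Fd f (x + s *\<^sub>R v) v) (at s)"
proof -
  have "((\<lambda>s. x + s *\<^sub>R v) has_derivative (\<lambda>h. h *\<^sub>R v)) (at s)"
    by (auto intro!: derivative_eq_intros)
  from diff_chain_at[OF this, of f] assms
  have "((\<lambda>s. f (x + s *\<^sub>R v)) has_derivative (\<lambda>h. Fd f (x + s *\<^sub>R v) (h *\<^sub>R v))) (at s)"
    by (auto simp: o_def frechet_derivative_works)
  moreover have "Fd f (x + s *\<^sub>R v) (h *\<^sub>R v) = Fd f (x + s *\<^sub>R v) v * h" for h
    by (simp add: linear_cmul[OF linear_frechet_derivative[OF assms]])
  ultimately show ?thesis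
    by (simp add: has_field_derivative_def)
qed

text \<open>Two applications of the mean value theorem, in the direction \<open>v\<close> and then in the direction \<open>w\<close>,
  to the second difference of \<open>f\<close>. The second difference is symmetric in \<open>v\<close> and \<open>w\<close>, so that it
  also has the same expression with the order of differentiation exchanged.\<close>

lemma second_difference_mean_value:
  fixes f :: "'a::euclidean_space \<Rightarrow> real"
  assumes f: "smooth_on S f" and h: "0 < h"
    and seg: "\<And>s t. 0 \<le> s \<Longrightarrow> s \<le> h \<Longrightarrow> 0 \<le> t \<Longrightarrow> t \<le> h \<Longrightarrow> x + s *\<^sub>R v + t *\<^sub>R w \<in> S"
  shows "\<exists>s t. 0 < s \<and> s < h \<and> 0 < t \<and> t < h \<and>
    f (x + h *\<^sub>R v + h *\<^sub>R w) - f (x + h *\<^sub>R v) - f (x + h *\<^sub>R w) + f x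
      = h * h * Fd (\<lambda>z. Fd f z v) (x + s *\<^sub>R v + t *\<^sub>R w) w"
proof -
  let ?\<phi> = "\<lambda>s. f ((x + h *\<^sub>R w) + s *\<^sub>R v) - f (x + s *\<^sub>R v)"
  have "DERIV ?\<phi> s :> Fd f ((x + h *\<^sub>R w) + s *\<^sub>R v) v - Fd f (x + s *\<^sub>R v) v"
    if "0 \<le> s" "s \<le> h" for s
  proof (intro DERIV_diff has_field_derivative_along_line smooth_on_differentiable[OF f])
    show "x + h *\<^sub>R w + s *\<^sub>R v \<in> S" "x + s *\<^sub>R v \<in> S"
      using seg[of s h] seg[of s 0] that h by (auto simp: algebra_simps)
  qed
  from MVT2[OF h this] obtain s where s: "0 < s" "s < h"
    and 1: "?\<phi> h - ?\<phi> 0 = h * (Fd f ((x + h *\<^sub>R w) + s *\<^sub>R v) v - Fd f (x + s *\<^sub>R v) v)"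
    by auto
  let ?\<psi> = "\<lambda>t. Fd f ((x + s *\<^sub>R v) + t *\<^sub>R w) v"
  have "DERIV ?\<psi> t :> Fd (\<lambda>z. Fd f z v) ((x + s *\<^sub>R v) + t *\<^sub>R w) w"
    if "0 \<le> t" "t \<le> h" for t
    using seg[of s t] s that
    by (intro has_field_derivative_along_line smooth_on_differentiable[OF smooth_on_Fd[OF f]]) auto
  from MVT2[OF h this] obtain t where t: "0 < t" "t < h"
    and 2: "?\<psi> h - ?\<psi> 0 = h * Fd (\<lambda>z. Fd f z v) ((x + s *\<^sub>R v) + t *\<^sub>R w) w"
    by auto
  have "?\<phi> h - ?\<phi> 0 = h * (?\<psi> h - ?\<psi> 0)"
    unfolding 1 by (simp add: algebra_simps)
  then have "?\<phi> h - ?\<phi> 0 = h * h * Fd (\<lambda>z. Fd f z v) (x + s *\<^sub>R v + t *\<^sub>R w) w"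
    unfolding 2 by simp
  moreover have "?\<phi> h - ?\<phi> 0
      = f (x + h *\<^sub>R v + h *\<^sub>R w) - f (x + h *\<^sub>R v) - f (x + h *\<^sub>R w) + f x"
    by (simp add: algebra_simps)
  ultimately show ?thesis
    using s t by metis
qed

text \<open>Both second derivatives are within \<open>e/2\<close> of their values at \<open>x\<close> near \<open>x\<close>, and somewhere near \<open>x\<close>
  they equal the same second difference divided by the square of the step.\<close>

lemma Fd_Fd_commute_real:
  fixes f :: "'a::euclidean_space \<Rightarrow> real"
  assumes S: "open S" and f: "smooth_on S f" and x: "x \<in> S"
  shows "Fd (\<lambda>z. Fd f z v) x w = Fd (\<lambda>z. Fd f z w) x v"
proof -
  define g where "g v w z = Fd (\<lambda>z. Fd f z v) z w" for v w z
  have "\<bar>g v w x - g w v x\<bar> \<le> e" if "e > 0" for e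
  proof -
    have cont: "isCont (g v' w') x" for v' w'
      using smooth_on_continuous[OF smooth_on_Fd[OF smooth_on_Fd[OF f, of v'], of w']] S x
      unfolding g_def by (simp add: continuous_on_eq_continuous_at)
    have near_x: "\<exists>d>0. \<forall>z. dist z x < d \<longrightarrow> dist (g v' w' z) (g v' w' x) < e/2" for v' w'
      using cont[of v' w'] half_gt_zero[OF \<open>e > 0\<close>] unfolding continuous_at_eps_delta by blast
    from near_x[of v w] near_x[of w v] obtain d1 d2 where d1: "d1 > 0" "\<And>z. dist z x < d1 \<Longrightarrow> dist (g v w z) (g v w x) < e/2"
      and d2: "d2 > 0" "\<And>z. dist z x < d2 \<Longrightarrow> dist (g w v z) (g w v x) < e/2"
      by blast
    obtain d0 where d0: "d0 > 0" "ball x d0 \<subseteq> S"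
      using S x open_contains_ball by blast
    define d where "d = min d0 (min d1 d2)"
    have d: "d > 0" using d0 d1 d2 by (simp add: d_def)
    \<comment> \<open>Adding 1 keeps the denominator positive when both directions vanish.\<close>
    define h where "h = d / (norm v + norm w + 1)"
    have pos: "norm v + norm w + 1 > 0"
      using norm_ge_zero[of v] norm_ge_zero[of w] by linarith
    have h: "h > 0" using d pos by (simp add: h_def)
    have near: "dist (x + s *\<^sub>R v + t *\<^sub>R w) x < d"
      if "0 \<le> s" "s \<le> h" "0 \<le> t" "t \<le> h" for s t
    proof -
      have "dist (x + s *\<^sub>R v + t *\<^sub>R w) x \<le> norm (s *\<^sub>R v) + norm (t *\<^sub>R w)"
        by (metis add.assoc add_diff_cancel_left' dist_norm norm_triangle_ineq)
      also have "\<dots> \<le> h * norm v + h * norm w"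
        using that by (auto intro!: add_mono mult_right_mono)
      also have "\<dots> < h * (norm v + norm w + 1)"
        using h by (simp add: algebra_simps)
      also have "\<dots> = d" using pos by (simp add: h_def)
      finally show ?thesis .
    qed
    have seg: "x + s *\<^sub>R v + t *\<^sub>R w \<in> S" if "0 \<le> s" "s \<le> h" "0 \<le> t" "t \<le> h" for s t
      using near[OF that] d0 by (auto simp: d_def dist_commute)
    obtain s t where st: "0 < s" "s < h" "0 < t" "t < h" and
      1: "f (x + h *\<^sub>R v + h *\<^sub>R w) - f (x + h *\<^sub>R v) - f (x + h *\<^sub>R w) + f x
        = h * h * g v w (x + s *\<^sub>R v + t *\<^sub>R w)"
      using second_difference_mean_value[OF f h seg] unfolding g_def by blast
    have seg': "x + s *\<^sub>R w + t *\<^sub>R v \<in> S" if "0 \<le> s" "s \<le> h" "0 \<le> t" "t \<le> h" for s t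
      using seg[of t s] that by (simp add: algebra_simps)
    obtain s' t' where st': "0 < s'" "s' < h" "0 < t'" "t' < h" and
      2: "f (x + h *\<^sub>R w + h *\<^sub>R v) - f (x + h *\<^sub>R w) - f (x + h *\<^sub>R v) + f x
        = h * h * g w v (x + s' *\<^sub>R w + t' *\<^sub>R v)"
      using second_difference_mean_value[OF f h seg'] unfolding g_def by blast
    have "h * h * g v w (x + s *\<^sub>R v + t *\<^sub>R w) = h * h * g w v (x + s' *\<^sub>R w + t' *\<^sub>R v)"
      unfolding 1[symmetric] 2[symmetric] by (simp add: algebra_simps)
    then have eq: "g v w (x + s *\<^sub>R v + t *\<^sub>R w) = g w v (x + t' *\<^sub>R v + s' *\<^sub>R w)"
      using h by (simp add: algebra_simps)
    have "dist (g v w (x + s *\<^sub>R v + t *\<^sub>R w)) (g v w x) < e/2"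
      by (rule d1(2)) (use near[of s t] st in \<open>simp add: d_def\<close>)
    moreover have "dist (g w v (x + t' *\<^sub>R v + s' *\<^sub>R w)) (g w v x) < e/2"
      by (rule d2(2)) (use near[of t' s'] st' in \<open>simp add: d_def\<close>)
    ultimately show ?thesis
      unfolding eq dist_real_def by linarith
  qed
  from field_le_epsilon[of "\<bar>g v w x - g w v x\<bar>" 0] this have "\<bar>g v w x - g w v x\<bar> \<le> 0"
    by simp
  then show ?thesis by (simp add: g_def)
qed

lemma Fd_Fd_commute:
  fixes f :: "'a::euclidean_space \<Rightarrow> 'b::euclidean_space"
  assumes S: "open S" and f: "smooth_on S f" and x: "x \<in> S"
  shows "Fd (\<lambda>z. Fd f z v) x w = Fd (\<lambda>z. Fd f z w) x v"
proof (rule euclidean_eqI)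
  fix b :: 'b
  have bl: "bounded_linear (\<lambda>y :: 'b. y \<bullet> b)" by (rule bounded_linear_inner_left)
  have inner: "Fd (\<lambda>z. k z \<bullet> b) z u = Fd k z u \<bullet> b" if "smooth_on S k" "z \<in> S" for k :: "'a \<Rightarrow> 'b" and z u
    using Fd_eqI[OF bounded_linear.has_derivative[OF bl smooth_on_has_derivative[OF that]]] by simp
  have "Fd (\<lambda>z. Fd f z v) x w \<bullet> b = Fd (\<lambda>z. Fd (\<lambda>z. f z \<bullet> b) z v) x w" for v w
    unfolding inner[OF smooth_on_Fd[OF f] x, symmetric]
    by (rule fun_cong[OF Fd_cong_open(2)[OF S x]]) (simp add: inner[OF f])
  then show "Fd (\<lambda>z. Fd f z v) x w \<bullet> b = Fd (\<lambda>z. Fd f z w) x v \<bullet> b"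
    using Fd_Fd_commute_real[OF S smooth_on_bounded_linear[OF bl S f] x] by simp
qed

section \<open>The tangent map and the Lagrange covector\<close>

lemma linear_eq_sum_Basis:
  fixes h :: "'a::euclidean_space \<Rightarrow> 'b::real_vector"
  assumes "linear h"
  shows "h q = (\<Sum>e\<in>Basis. (q \<bullet> e) *\<^sub>R h e)"
proof -
  have "h (\<Sum>e\<in>Basis. (q \<bullet> e) *\<^sub>R e) = (\<Sum>e\<in>Basis. (q \<bullet> e) *\<^sub>R h e)"
    by (simp add: linear_sum[OF assms] linear_cmul[OF assms] del: euclidean_representation)
  then show ?thesis by (simp add: euclidean_representation)
qed

text \<open>The chain rule needs the derivative of \<open>Df(p) q\<close> in \<open>p\<close> and \<open>q\<close> together, while smoothness is
  stated for one fixed direction at a time. Expanding \<open>q\<close> in the basis reduces the former to the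
  latter.\<close>

lemma has_derivative_Fd_joint:
  fixes f :: "'a::euclidean_space \<Rightarrow> 'b::real_normed_vector"
  assumes S: "open S" and f: "smooth_on S f" and p: "p \<in> S"
  shows "((\<lambda>u. Fd f (fst u) (snd u)) has_derivative
    (\<lambda>k. Fd (\<lambda>z. Fd f z q) p (fst k) + Fd f p (snd k))) (at (p, q))"
proof -
  note dFd = smooth_on_has_derivative[OF smooth_on_Fd[OF f] p]
  have "((\<lambda>z. Fd f z q) has_derivative (\<lambda>a. \<Sum>e\<in>Basis. (q \<bullet> e) *\<^sub>R Fd (\<lambda>z. Fd f z e) p a)) (at p)"
  proof (rule has_derivative_transform_within_open[OF _ S p])
    show "((\<lambda>z. \<Sum>e\<in>Basis. (q \<bullet> e) *\<^sub>R Fd f z e) has_derivative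
        (\<lambda>a. \<Sum>e\<in>Basis. (q \<bullet> e) *\<^sub>R Fd (\<lambda>z. Fd f z e) p a)) (at p)"
      by (intro has_derivative_sum has_derivative_scaleR_right dFd)
  qed (simp add: linear_eq_sum_Basis[OF linear_Fd[OF f], symmetric])
  note q = fun_cong[OF Fd_eqI[OF this]]
  show ?thesis
  proof (rule has_derivative_transform_within_open[of _ _ _ UNIV "S \<times> UNIV"])
    have "((\<lambda>u. Fd f (fst u) e) has_derivative (\<lambda>k. Fd (\<lambda>z. Fd f z e) p (fst k))) (at (p, q))" for e
      by (rule has_derivative_compose[OF has_derivative_fst[OF has_derivative_ident]]) (simp add: dFd)
    then have "((\<lambda>u. (snd u \<bullet> e) *\<^sub>R Fd f (fst u) e) has_derivative
      (\<lambda>k. (snd (p, q) \<bullet> e) *\<^sub>R Fd (\<lambda>z. Fd f z e) p (fst k) + (snd k \<bullet> e) *\<^sub>R Fd f (fst (p, q)) e)) (at (p, q))"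
      for e
      by (intro has_derivative_scaleR has_derivative_inner_left has_derivative_snd has_derivative_ident)
    then have "((\<lambda>u. \<Sum>e\<in>Basis. (snd u \<bullet> e) *\<^sub>R Fd f (fst u) e) has_derivative
      (\<lambda>k. \<Sum>e\<in>Basis. (snd (p, q) \<bullet> e) *\<^sub>R Fd (\<lambda>z. Fd f z e) p (fst k) + (snd k \<bullet> e) *\<^sub>R Fd f (fst (p, q)) e)) (at (p, q))"
      by (intro has_derivative_sum)
    then show "((\<lambda>u. \<Sum>e\<in>Basis. (snd u \<bullet> e) *\<^sub>R Fd f (fst u) e) has_derivative
      (\<lambda>k. Fd (\<lambda>z. Fd f z q) p (fst k) + Fd f p (snd k))) (at (p, q))"
      by (simp add: sum.distrib q linear_eq_sum_Basis[OF linear_Fd[OF f p], symmetric])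
    show "open (S \<times> (UNIV :: 'a set))" "(p, q) \<in> S \<times> UNIV"
      using S p by (auto intro: open_Times)
    show "(\<Sum>e\<in>Basis. (snd u \<bullet> e) *\<^sub>R Fd f (fst u) e) = Fd f (fst u) (snd u)"
      if "u \<in> S \<times> UNIV" for u
      using that by (auto simp: linear_eq_sum_Basis[OF linear_Fd[OF f], symmetric])
  qed
qed

definition tangent_map :: "('a::euclidean_space \<Rightarrow> 'b::euclidean_space) \<Rightarrow> 'a \<times> 'a \<Rightarrow> 'b \<times> 'b" where
  "tangent_map \<phi> u = (\<phi> (fst u), Fd \<phi> (fst u) (snd u))"

lemma has_derivative_tangent_map:
  assumes U: "open U" and \<phi>: "smooth_on U \<phi>" and u: "fst u \<in> U"
  shows "(tangent_map \<phi> has_derivative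
    (\<lambda>k. (Fd \<phi> (fst u) (fst k), Fd (\<lambda>z. Fd \<phi> z (snd u)) (fst u) (fst k) + Fd \<phi> (fst u) (snd k)))) (at u)"
  unfolding tangent_map_def[abs_def]
  by (rule has_derivative_Pair[OF has_derivative_compose[OF has_derivative_fst[OF has_derivative_ident]
      smooth_on_has_derivative[OF \<phi> u]]])
    (use has_derivative_Fd_joint[OF U \<phi> u, of "snd u"] in simp)

text \<open>The Euler-Lagrange expression \<open>d/dt (\<partial>f/\<partial>y) - \<partial>f/\<partial>x\<close> at \<open>u = (x, y)\<close>, evaluated on \<open>w\<close>, as a
  function of the acceleration \<open>b\<close>. Being free of coordinates, it can be transformed by the chain
  rule.\<close>

definition lagrange_covector ::
  "('a::euclidean_space \<times> 'a \<Rightarrow> real) \<Rightarrow> 'a \<times> 'a \<Rightarrow> 'a \<Rightarrow> 'a \<Rightarrow> real" where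
  "lagrange_covector f u b w = Fd (\<lambda>u'. Fd f u' (0, w)) u (snd u, b) - Fd f u (w, 0)"

text \<open>Write \<open>T\<close> for the tangent map, \<open>x\<close> and \<open>y\<close> for the components of \<open>u\<close>. By the chain rule the
  first term for \<open>g = f \<circ> T\<close> is the first term for \<open>f\<close> plus \<open>Df (0, D\<^sup>2\<phi>(y, w))\<close>, and the second
  term is \<open>Df (D\<phi> w, D\<^sup>2\<phi>(w, y))\<close>. By symmetry of \<open>D\<^sup>2\<phi>\<close> the contributions of \<open>D\<^sup>2\<phi>\<close> cancel.\<close>

lemma lagrange_covector_natural:
  fixes \<phi> :: "'a::euclidean_space \<Rightarrow> 'b::euclidean_space"
  assumes U: "open U" and \<phi>: "smooth_on U \<phi>" and V: "open V" and f: "smooth_on V f"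
    and W: "open W" and u: "u \<in> W"
    and WU: "\<And>u'. u' \<in> W \<Longrightarrow> fst u' \<in> U" and WV: "\<And>u'. u' \<in> W \<Longrightarrow> tangent_map \<phi> u' \<in> V"
    and g: "\<And>u'. u' \<in> W \<Longrightarrow> g u' = f (tangent_map \<phi> u')"
  shows "lagrange_covector g u b w =
    lagrange_covector f (tangent_map \<phi> u) (snd (Fd (tangent_map \<phi>) u (snd u, b))) (Fd \<phi> (fst u) w)"
proof -
  let ?T = "tangent_map \<phi>"
  obtain x y where xy: "u = (x, y)" by (cases u)
  have x: "x \<in> U" using WU[OF u] by (simp add: xy)
  note dT = has_derivative_tangent_map[OF U \<phi> WU]
  have Fg: "Fd g u' k = Fd f (?T u') (Fd ?T u' k)" if "u' \<in> W" for u' k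
  proof -
    have "Fd g u' = Fd (\<lambda>u'. f (?T u')) u'"
      by (rule Fd_cong_open(2)[OF W that g])
    also have "\<dots> = (\<lambda>k. Fd f (?T u') (Fd ?T u' k))"
      unfolding Fd_eqI[OF dT[OF that]]
      by (rule Fd_eqI, rule has_derivative_compose[OF dT[OF that] smooth_on_has_derivative[OF f WV[OF that]]])
    finally show ?thesis by simp
  qed
  have Tk: "Fd ?T u' k = (Fd \<phi> (fst u') (fst k),
      Fd (\<lambda>z. Fd \<phi> z (snd u')) (fst u') (fst k) + Fd \<phi> (fst u') (snd k))" if "u' \<in> W" for u' k
    using Fd_eqI[OF dT[OF that]] by simp
  have lin0: "Fd \<phi> (fst u') 0 = 0" "Fd (\<lambda>z. Fd \<phi> z c) (fst u') 0 = 0" if "u' \<in> W" for u' c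
    using linear_0[OF linear_Fd[OF \<phi> WU[OF that]]]
      linear_0[OF linear_Fd[OF smooth_on_Fd[OF \<phi>] WU[OF that]]] by auto
  let ?q = "Fd (\<lambda>z. Fd \<phi> z w) x"
  have dq: "((\<lambda>u'. Fd \<phi> (fst u') w) has_derivative (\<lambda>k. ?q (fst k))) (at u)"
    by (rule has_derivative_compose[OF has_derivative_fst[OF has_derivative_ident]])
      (use smooth_on_has_derivative[OF smooth_on_Fd[OF \<phi>] x] in \<open>simp add: xy\<close>)
  have "Fd (\<lambda>u'. Fd g u' (0, w)) u = Fd (\<lambda>u'. Fd f (?T u') (0, Fd \<phi> (fst u') w)) u"
    by (rule Fd_cong_open(2)[OF W u]) (simp add: Fg Tk lin0)
  also have "\<dots> = (\<lambda>k. Fd (\<lambda>z. Fd f z (0, Fd \<phi> x w)) (?T u) (Fd ?T u k) + Fd f (?T u) (0, ?q (fst k)))"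
  proof (rule Fd_eqI)
    have "((\<lambda>u'. (?T u', (0::'b, Fd \<phi> (fst u') w))) has_derivative (\<lambda>k. (Fd ?T u k, (0, ?q (fst k))))) (at u)"
      using dT[OF u] dq unfolding Fd_eqI[OF dT[OF u]]
      by (intro has_derivative_Pair has_derivative_const)
    from has_derivative_compose[OF this
      has_derivative_Fd_joint[OF V f WV[OF u], of "(0, Fd \<phi> (fst u) w)"]]
    show "((\<lambda>u'. Fd f (?T u') (0, Fd \<phi> (fst u') w)) has_derivative
      (\<lambda>k. Fd (\<lambda>z. Fd f z (0, Fd \<phi> x w)) (?T u) (Fd ?T u k) + Fd f (?T u) (0, ?q (fst k)))) (at u)"
      by (simp add: xy)
  qed
  finally have 1: "Fd (\<lambda>u'. Fd g u' (0, w)) u (y, b) =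
      Fd (\<lambda>z. Fd f z (0, Fd \<phi> x w)) (?T u) (Fd ?T u (y, b)) + Fd f (?T u) (0, ?q y)"
    by simp
  have "Fd g u (w, 0) = Fd f (?T u) (Fd \<phi> x w, Fd (\<lambda>z. Fd \<phi> z y) x w)"
    using Fg[OF u] Tk[OF u] lin0[OF u] by (simp add: xy)
  also have "Fd (\<lambda>z. Fd \<phi> z y) x w = ?q y"
    by (rule Fd_Fd_commute[OF U \<phi> x])
  also have "Fd f (?T u) (Fd \<phi> x w, ?q y) = Fd f (?T u) (Fd \<phi> x w, 0) + Fd f (?T u) (0, ?q y)"
    using linear_add[OF linear_Fd[OF f WV[OF u]], of "(Fd \<phi> x w, 0)" "(0, ?q y)"] by simp
  finally have 2: "Fd g u (w, 0) = \<dots>" .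
  \<comment> \<open>The horizontal part of \<open>DT (y, b)\<close> is \<open>D\<phi> y\<close>, the velocity at \<open>T u\<close>, as the definition of the covector at \<open>T u\<close> demands.\<close>
  have 3: "Fd ?T u (y, b) = (snd (?T u), snd (Fd ?T u (y, b)))"
    using Tk[OF u] by (simp add: xy tangent_map_def)
  show ?thesis
    unfolding lagrange_covector_def 2 using 1 3 by (simp add: xy)
qed

lemma lagrange_covector_linear:
  assumes V: "open V" and f: "smooth_on V f" and u: "u \<in> V"
  shows "linear (lagrange_covector f u b)"
proof -
  have "lagrange_covector f u b = (\<lambda>w. Fd (\<lambda>u'. Fd f u' (snd u, b)) u (0, w) - Fd f u (w, 0))"
    unfolding lagrange_covector_def using Fd_Fd_commute[OF V f u] by simp
  moreover have "linear (\<lambda>w. Fd (\<lambda>u'. Fd f u' (snd u, b)) u (0, w))" "linear (\<lambda>w. Fd f u (w, 0))"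
    using linear_compose[OF _ linear_Fd[OF smooth_on_Fd[OF f] u], of "\<lambda>w. (0, w)"]
      linear_compose[OF _ linear_Fd[OF f u], of "\<lambda>w. (w, 0)"]
    by (auto simp: o_def linear_iff)
  ultimately show ?thesis by (simp add: linear_compose_sub)
qed

section \<open>Coordinates: the Lagrange covector and the coefficients of the semispray\<close>

lemma vec_eq_sum_axis: "(x :: real ^ 'n::finite) = (\<Sum>i\<in>UNIV. x $ i *\<^sub>R axis i 1)"
  by (auto simp: vec_eq_iff axis_def if_distrib cong: if_cong)

lemma linear_eq_sum_axis:
  fixes h :: "real ^ 'n::finite \<Rightarrow> 'b::real_vector"
  assumes "linear h"
  shows "h x = (\<Sum>i\<in>UNIV. x $ i *\<^sub>R h (axis i 1))"
  by (subst vec_eq_sum_axis) (simp add: linear_sum[OF assms] linear_cmul[OF assms])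

lemma two_G0_eq:
  "two_G0 L C u = (1/2) *\<^sub>R (matrix_inv (metric_matrix L C u) *v
     (\<chi> s. (\<Sum>h\<in>UNIV. partial_y s (partial_x h (L \<circ> chart_inv C)) u * snd u $ h)
        - partial_x s (L \<circ> chart_inv C) u))"
  by (simp add: two_G0_def matrix_vector_mult_def vec_eq_iff)

text \<open>Expanding \<open>(y, b)\<close> in the coordinate directions turns the covector into
  \<open>(\<partial>\<^sup>2L/\<partial>y\<^sup>i\<partial>x\<^sup>h y\<^sup>h - \<partial>L/\<partial>x\<^sup>i) + 2 g\<^sub>i\<^sub>j b\<^sup>j\<close>, and the bracket is \<open>2 g\<close> applied to \<open>two_G0\<close> by the
  definition of the latter. The symmetry of second derivatives is used because \<open>two_G0\<close> and the
  covector differentiate in opposite orders.\<close>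

lemma lagrange_covector_axis:
  assumes V: "open V" and f: "smooth_on V (L \<circ> chart_inv C)" and u: "u \<in> V"
    and inv: "invertible (metric_matrix L C u)"
  shows "lagrange_covector (L \<circ> chart_inv C) u b (axis i 1)
    = 2 * (metric_matrix L C u *v (b + two_G0 L C u)) $ i"
proof -
  let ?f = "L \<circ> chart_inv C" and ?g = "metric_matrix L C u"
  let ?E = "\<chi> s. (\<Sum>h\<in>UNIV. partial_y s (partial_x h ?f) u * snd u $ h) - partial_x s ?f u"
  let ?P = "Fd (\<lambda>u'. Fd ?f u' (0, axis i 1)) u"
  have lin: "linear ?P" by (rule linear_Fd[OF smooth_on_Fd[OF f] u])
  have "?P (snd u, b) = ?P (snd u, 0) + ?P (0, b)"
    using linear_add[OF lin, of "(snd u, 0)" "(0, b)"] by simp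
  also have "?P (snd u, 0) = (\<Sum>h\<in>UNIV. snd u $ h *\<^sub>R ?P (axis h 1, 0))"
    by (rule linear_eq_sum_axis) (use linear_compose[OF _ lin, of "\<lambda>w. (w, 0)"] in \<open>auto simp: o_def linear_iff\<close>)
  also have "\<dots> = (\<Sum>h\<in>UNIV. partial_y i (partial_x h ?f) u * snd u $ h)"
    unfolding partial_x_def[abs_def] partial_y_def[abs_def] Fd_Fd_commute[OF V f u, of "(0, axis i 1)"]
    by (simp add: mult.commute)
  also have "?P (0, b) = (\<Sum>j\<in>UNIV. b $ j *\<^sub>R ?P (0, axis j 1))"
    by (rule linear_eq_sum_axis) (use linear_compose[OF _ lin, of "\<lambda>w. (0, w)"] in \<open>auto simp: o_def linear_iff\<close>)
  also have "\<dots> = 2 * (?g *v b) $ i"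
    unfolding metric_matrix_def partial_y_def[abs_def] Fd_Fd_commute[OF V f u, of "(0, axis i 1)"]
    by (simp add: matrix_vector_mult_def sum_distrib_left mult.commute)
  finally have "lagrange_covector ?f u b (axis i 1) = ?E $ i + 2 * (?g *v b) $ i"
    unfolding lagrange_covector_def vec_lambda_beta partial_x_def[of i] by (simp only: diff_add_eq)
  moreover have "?g *v (2 *\<^sub>R two_G0 L C u) = ?E"
    using matrix_inv_mult_eq_iff[OF inv, THEN iffD1, OF refl] by (simp add: two_G0_eq)
  then have "?E $ i = 2 * (?g *v two_G0 L C u) $ i"
    by (metis matrix_vector_mult_scaleR vector_scaleR_component real_scaleR_def)
  ultimately show ?thesis
    by (simp add: matrix_vector_right_distrib)
qed

lemma lagrange_covector_eq_lower_force_iff: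
  assumes V: "open V" and f: "smooth_on V (L \<circ> chart_inv C)" and u: "u \<in> V"
    and inv: "invertible (metric_matrix L C u)"
  shows "(\<forall>i. lagrange_covector (L \<circ> chart_inv C) u b (axis i 1) = lower_force L Fe C u $ i)
    \<longleftrightarrow> b = - two_G L Fe C u"
proof -
  let ?g = "metric_matrix L C u" and ?F = "force Fe C u"
  have "lower_force L Fe C u = ?g *v ?F"
    by (simp add: lower_force_def matrix_vector_mult_def)
  then have "(\<forall>i. lagrange_covector (L \<circ> chart_inv C) u b (axis i 1) = lower_force L Fe C u $ i)
      \<longleftrightarrow> 2 *\<^sub>R (?g *v (b + two_G0 L C u)) = ?g *v ?F"
    by (simp add: lagrange_covector_axis[OF assms] vec_eq_iff)
  also have "\<dots> \<longleftrightarrow> ?g *v (2 *\<^sub>R (b + two_G0 L C u)) = ?g *v ?F"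
    by (simp add: matrix_vector_mult_scaleR)
  also have "\<dots> \<longleftrightarrow> 2 *\<^sub>R (b + two_G0 L C u) = ?F"
    using matrix_inv_mult_eq_iff[OF inv] by metis
  also have "\<dots> \<longleftrightarrow> b = - two_G L Fe C u"
    by (auto simp: two_G_def vec_eq_iff field_simps)
  finally show ?thesis .
qed

text \<open>The case of vanishing force. The condition is stated for all \<open>w\<close>, not only for the coordinate
  directions, since a change of chart maps the latter to arbitrary vectors.\<close>

lemma lagrange_covector_eq_0_iff:
  assumes V: "open V" and f: "smooth_on V (L \<circ> chart_inv C)" and u: "u \<in> V"
    and inv: "invertible (metric_matrix L C u)"
  shows "(\<forall>w. lagrange_covector (L \<circ> chart_inv C) u b w = 0) \<longleftrightarrow> b = - two_G0 L C u"
proof -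
  have "(\<forall>w. lagrange_covector (L \<circ> chart_inv C) u b w = 0)
      \<longleftrightarrow> (\<forall>i. lagrange_covector (L \<circ> chart_inv C) u b (axis i 1) = 0)"
  proof (intro iffI allI)
    fix w assume "\<forall>i. lagrange_covector (L \<circ> chart_inv C) u b (axis i 1) = 0"
    then show "lagrange_covector (L \<circ> chart_inv C) u b w = 0"
      by (subst linear_eq_sum_axis[OF lagrange_covector_linear[OF V f u]]) simp
  qed simp
  then show ?thesis
    \<comment> \<open>For the zero field both \<open>lower_force\<close> and the difference of \<open>two_G\<close> and \<open>two_G0\<close> vanish.\<close>
    using lagrange_covector_eq_lower_force_iff[OF assms, of b "\<lambda>_ _. 0"]
    by (simp add: two_G_def force_def lower_force_def)
qed

lemma two_G0_smooth:
  fixes L :: "'t \<Rightarrow> real" and C :: "('t, 'n::finite xy) chart"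
  assumes V: "open V" and f: "smooth_on V (L \<circ> chart_inv C)"
    and inv: "\<And>u. u \<in> V \<Longrightarrow> invertible (metric_matrix L C u)"
  shows "smooth_on V (two_G0 L C)"
  unfolding two_G0_eq[abs_def]
proof (intro smooth_on_scaleR[OF V] smooth_on_matrix_inv_mult[OF V _ _ inv])
  have nth: "smooth_on V (\<lambda>u :: 'n xy. snd u $ h)" for h
    by (intro smooth_on_linear bounded_linear_compose[OF bounded_linear_vec_nth bounded_linear_snd])
  show "smooth_on V (\<lambda>x. metric_matrix L C x $ i $ j)" for i j
    unfolding metric_matrix_def partial_y_def[abs_def]
    by (simp del: times_divide_eq_left) (intro smooth_on_mult[OF V] smooth_on_const smooth_on_Fd f)
  show "smooth_on V (\<lambda>x. (\<chi> s. (\<Sum>h\<in>UNIV. partial_y s (partial_x h (L \<circ> chart_inv C)) x * snd x $ h)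
      - partial_x s (L \<circ> chart_inv C) x) $ i)" for i
    unfolding partial_y_def[abs_def] partial_x_def[abs_def] vec_lambda_beta
    by (intro smooth_on_diff smooth_on_sum smooth_on_mult nth V smooth_on_Fd f)
qed

section \<open>Tangent vectors and induced charts\<close>

lemma chart_dom_induced_chart:
  "chart_dom (induced_chart A c) = {z. fst z \<in> chart_dom c \<and> snd z \<in> tangent_space A (fst z)}"
  by (auto simp: chart_dom_def induced_chart_def)

lemma chart_map_induced_chart: "chart_map (induced_chart A c) z = (chart_map c (fst z), snd z c)"
  by (simp add: chart_map_def induced_chart_def split_beta)

text \<open>By the cocycle identity for the derivatives of the transition maps this family is a tangent
  vector; it shows that every component occurs in a chart, so that the image of an induced
  chart is a full product.\<close>

definition tangent_vector :: "('a, 'e::euclidean_space) chart set \<Rightarrow> ('a, 'e) chart \<Rightarrow> 'a \<Rightarrow> 'e \<Rightarrow> ('a, 'e) tvec"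
  where "tangent_vector A c p w =
    (\<lambda>d. if d \<in> A \<and> p \<in> chart_dom d then Fd (transition c d) (chart_map c p) w else 0)"

lemma tangent_space_change_chart:
  "v \<in> tangent_space A p \<Longrightarrow> c \<in> A \<Longrightarrow> d \<in> A \<Longrightarrow> p \<in> chart_dom c \<Longrightarrow> p \<in> chart_dom d
    \<Longrightarrow> v d = Fd (transition c d) (chart_map c p) (v c)"
  unfolding tangent_space_def by blast

lemma tangent_space_off_chart:
  "v \<in> tangent_space A p \<Longrightarrow> \<not> (c \<in> A \<and> p \<in> chart_dom c) \<Longrightarrow> v c = 0"
  unfolding tangent_space_def by blast

context
  fixes A :: "('m, 'e::euclidean_space) chart set"
  assumes A: "smooth_atlas A"
begin

lemma chart_inv_chart_map:
  assumes "c \<in> A" "p \<in> chart_dom c" shows "chart_inv c (chart_map c p) = p"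
  using A assms unfolding smooth_atlas_def chart_inv_def by (auto intro: inv_into_f_f)

lemma open_chart_map_image:
  assumes "c \<in> A" shows "open (chart_map c ` chart_dom c)"
  using A assms unfolding smooth_atlas_def by blast

lemma open_chart_overlap:
  assumes "c \<in> A" "d \<in> A" shows "open (chart_map c ` (chart_dom c \<inter> chart_dom d))"
  using A assms unfolding smooth_atlas_def by blast

lemma smooth_transition:
  assumes "c \<in> A" "d \<in> A"
  shows "smooth_on (chart_map c ` (chart_dom c \<inter> chart_dom d)) (transition c d)"
  using A assms unfolding smooth_atlas_def by blast

lemma transition_chart_map:
  assumes "c \<in> A" "p \<in> chart_dom c" shows "transition c d (chart_map c p) = chart_map d p"
  by (simp add: transition_def chart_inv_chart_map[OF assms])

lemma transition_has_derivative:
  assumes "c \<in> A" "d \<in> A" "p \<in> chart_dom c" "p \<in> chart_dom d"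
  shows "(transition c d has_derivative Fd (transition c d) (chart_map c p)) (at (chart_map c p))"
  using assms by (intro smooth_on_has_derivative[OF smooth_transition]) auto

lemma transition_linear:
  assumes "c \<in> A" "d \<in> A" "p \<in> chart_dom c" "p \<in> chart_dom d"
  shows "linear (Fd (transition c d) (chart_map c p))"
  using transition_has_derivative[OF assms] has_derivative_linear by blast

text \<open>The cocycle identity: transition maps compose near the point, on the overlap of the three
  charts, and the chain rule applies there.\<close>

lemma Fd_transition_compose:
  assumes c: "c \<in> A" "p \<in> chart_dom c" and d: "d \<in> A" "p \<in> chart_dom d"
    and e: "e \<in> A" "p \<in> chart_dom e"
  shows "Fd (transition d e) (chart_map d p) (Fd (transition c d) (chart_map c p) v)
    = Fd (transition c e) (chart_map c p) v"
proof -
  let ?S = "chart_map c ` (chart_dom c \<inter> chart_dom d) \<inter> chart_map c ` (chart_dom c \<inter> chart_dom e)"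
  have "((\<lambda>x. transition d e (transition c d x)) has_derivative
      (\<lambda>v. Fd (transition d e) (chart_map d p) (Fd (transition c d) (chart_map c p) v))) (at (chart_map c p))"
    by (rule has_derivative_compose)
      (use transition_has_derivative c d e in \<open>auto simp: transition_chart_map\<close>)
  then have "(transition c e has_derivative
      (\<lambda>v. Fd (transition d e) (chart_map d p) (Fd (transition c d) (chart_map c p) v))) (at (chart_map c p))"
  proof (rule has_derivative_transform_within_open[of _ _ _ UNIV ?S])
    show "open ?S" using open_chart_overlap c d e by blast
    show "chart_map c p \<in> ?S" using c d e by blast
    fix x assume "x \<in> ?S"
    then obtain q where "q \<in> chart_dom c" "q \<in> chart_dom d" "x = chart_map c q"
      by blast
    then show "transition d e (transition c d x) = transition c e x"
      using c d e by (simp add: transition_chart_map)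
  qed
  then show ?thesis by (simp add: Fd_eqI)
qed

lemma Fd_transition_self:
  assumes c: "c \<in> A" "p \<in> chart_dom c"
  shows "Fd (transition c c) (chart_map c p) v = v"
proof -
  have "(transition c c has_derivative (\<lambda>v. v)) (at (chart_map c p))"
    by (rule has_derivative_transform_within_open[OF has_derivative_ident open_chart_map_image[OF c(1)]])
      (use c in \<open>auto simp: transition_chart_map\<close>)
  then show ?thesis by (simp add: Fd_eqI)
qed

lemma tangent_vector_in_tangent_space:
  assumes "c \<in> A" "p \<in> chart_dom c"
  shows "tangent_vector A c p w \<in> tangent_space A p"
  using assms by (auto simp: tangent_space_def tangent_vector_def Fd_transition_compose)

lemma tangent_vector_component:
  assumes "c \<in> A" "p \<in> chart_dom c"
  shows "tangent_vector A c p w c = w"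
  using assms by (simp add: tangent_vector_def Fd_transition_self)

lemma tangent_space_eq_iff:
  assumes "c \<in> A" "p \<in> chart_dom c" "v \<in> tangent_space A p" "v' \<in> tangent_space A p"
  shows "v = v' \<longleftrightarrow> v c = v' c"
proof
  assume eq: "v c = v' c"
  show "v = v'"
  proof
    fix d
    show "v d = v' d"
    proof (cases "d \<in> A \<and> p \<in> chart_dom d")
      case True
      then show ?thesis
        using tangent_space_change_chart[OF assms(3,1), of d]
          tangent_space_change_chart[OF assms(4,1), of d] assms(2) eq by simp
    next
      case False
      then show ?thesis
        using tangent_space_off_chart[OF assms(3)] tangent_space_off_chart[OF assms(4)] by metis
    qed
  qed
qed simp

lemma zero_in_tangent_space: "(\<lambda>c. 0) \<in> tangent_space A p"
proof -
  have "Fd (transition c d) (chart_map c p) 0 = 0"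
    if "c \<in> A" "d \<in> A" "p \<in> chart_dom c" "p \<in> chart_dom d" for c d
    by (rule linear_0[OF transition_linear[OF that]])
  then show ?thesis by (simp add: tangent_space_def)
qed

lemma chart_map_induced_image:
  assumes "c \<in> A" "W \<subseteq> chart_dom c"
  shows "chart_map (induced_chart A c) ` {z \<in> chart_dom (induced_chart A c). fst z \<in> W}
    = chart_map c ` W \<times> UNIV"
proof (intro equalityI subsetI)
  fix u assume "u \<in> chart_map c ` W \<times> (UNIV :: 'e set)"
  then obtain p w where p: "p \<in> W" and u: "u = (chart_map c p, w)" by blast
  have pc: "p \<in> chart_dom c" using p assms by blast
  have "u = chart_map (induced_chart A c) (p, tangent_vector A c p w)"
    using assms pc by (simp add: u chart_map_induced_chart tangent_vector_component)
  then show "u \<in> chart_map (induced_chart A c) ` {z \<in> chart_dom (induced_chart A c). fst z \<in> W}"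
    by (rule image_eqI) (use p pc assms in \<open>auto simp: chart_dom_induced_chart tangent_vector_in_tangent_space\<close>)
qed (auto simp: chart_map_induced_chart)

text \<open>A tangent vector is determined by its component in any one chart, so it is zero as soon as one
  component is.\<close>

lemma in_slit_TM_iff:
  assumes "c \<in> A" "z \<in> chart_dom (induced_chart A c)"
  shows "z \<in> slit_TM A \<longleftrightarrow> snd (chart_map (induced_chart A c) z) \<noteq> 0"
proof -
  have z: "fst z \<in> chart_dom c" "snd z \<in> tangent_space A (fst z)"
    using assms(2) by (simp_all add: chart_dom_induced_chart)
  have "z \<in> TM A"
    using z assms(1) by (auto simp: TM_def carrier_of_def split_beta)
  then have "z \<in> slit_TM A \<longleftrightarrow> snd z \<noteq> (\<lambda>c. 0)"
    by (simp add: slit_TM_def split_beta)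
  also have "\<dots> \<longleftrightarrow> snd z c \<noteq> 0"
    using tangent_space_eq_iff[OF assms(1) z zero_in_tangent_space] by simp
  finally show ?thesis by (simp add: chart_map_induced_chart)
qed

lemma chart_map_induced_slit_image:
  assumes "c \<in> A" "W \<subseteq> chart_dom c"
  shows "chart_map (induced_chart A c) ` {z \<in> chart_dom (induced_chart A c) \<inter> slit_TM A. fst z \<in> W}
    = chart_map c ` W \<times> (- {0})"
proof -
  let ?C = "induced_chart A c"
  define R :: "('e \<times> 'e) set" where "R = UNIV \<times> (- {0})"
  have R: "z \<in> slit_TM A \<longleftrightarrow> chart_map ?C z \<in> R" if "z \<in> chart_dom ?C" for z
    by (simp add: R_def in_slit_TM_iff[OF assms(1) that] mem_Times_iff)
  have "{z \<in> chart_dom ?C \<inter> slit_TM A. fst z \<in> W}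
      = {z \<in> {z \<in> chart_dom ?C. fst z \<in> W}. chart_map ?C z \<in> R}"
    using R by blast
  then have "chart_map ?C ` {z \<in> chart_dom ?C \<inter> slit_TM A. fst z \<in> W}
      = chart_map ?C ` {z \<in> chart_dom ?C. fst z \<in> W} \<inter> R"
    by (simp only:) blast
  then show ?thesis
    unfolding chart_map_induced_image[OF assms] by (simp add: R_def Times_Int_Times)
qed

lemma chart_inv_induced_chart:
  assumes "c \<in> A" "z \<in> chart_dom (induced_chart A c)"
  shows "chart_inv (induced_chart A c) (chart_map (induced_chart A c) z) = z"
proof -
  have "inj_on (chart_map (induced_chart A c)) (chart_dom (induced_chart A c))"
  proof (rule inj_onI)
    fix z z' assume z: "z \<in> chart_dom (induced_chart A c)" "z' \<in> chart_dom (induced_chart A c)"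
      and eq: "chart_map (induced_chart A c) z = chart_map (induced_chart A c) z'"
    have dom: "fst z \<in> chart_dom c" "fst z' \<in> chart_dom c"
      and ts: "snd z \<in> tangent_space A (fst z)" "snd z' \<in> tangent_space A (fst z')"
      using z by (simp_all add: chart_dom_induced_chart)
    have coord: "chart_map c (fst z) = chart_map c (fst z')" "snd z c = snd z' c"
      using eq by (simp_all add: chart_map_induced_chart)
    have "fst z = fst z'"
      using arg_cong[OF coord(1), of "chart_inv c"]
      by (simp only: chart_inv_chart_map[OF assms(1) dom(1)] chart_inv_chart_map[OF assms(1) dom(2)])
    moreover have "snd z = snd z'"
      using tangent_space_eq_iff[OF assms(1) dom(1) ts(1)] ts(2) coord(2) \<open>fst z = fst z'\<close> by metis
    ultimately show "z = z'" by (simp add: prod_eq_iff)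
  qed
  then show ?thesis
    unfolding chart_inv_def using assms(2) by (rule inv_into_f_f)
qed

lemma transition_induced_chart_map:
  assumes "c \<in> A" "z \<in> chart_dom (induced_chart A c)"
  shows "transition (induced_chart A c) D (chart_map (induced_chart A c) z) = chart_map D z"
  by (simp add: transition_def chart_inv_induced_chart[OF assms])

text \<open>The change of coordinates of \<open>TM\<close> induced by a change of coordinates of \<open>M\<close> is its tangent map.\<close>

lemma chart_map_eq_tangent_map:
  assumes c: "c \<in> A" "z \<in> chart_dom (induced_chart A c)"
    and d: "d \<in> A" "z \<in> chart_dom (induced_chart A d)"
  shows "chart_map (induced_chart A d) z
    = tangent_map (transition c d) (chart_map (induced_chart A c) z)"
  using assms tangent_space_change_chart[of "snd z" A "fst z" c d]
  by (simp add: tangent_map_def chart_map_induced_chart chart_dom_induced_chart transition_chart_map)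

text \<open>The transition map of the induced charts agrees with the tangent map only on the image of the
  overlap; this image is open, which is enough for the derivatives to agree.\<close>

lemma transition_induced_has_derivative:
  assumes c: "c \<in> A" "z \<in> chart_dom (induced_chart A c)"
    and d: "d \<in> A" "z \<in> chart_dom (induced_chart A d)"
  defines "u \<equiv> chart_map (induced_chart A c) z"
  shows "(transition (induced_chart A c) (induced_chart A d) has_derivative
      Fd (tangent_map (transition c d)) u) (at u)"
    and "Fd (transition (induced_chart A c) (induced_chart A d)) u = Fd (tangent_map (transition c d)) u"
    and "Fd (tangent_map (transition c d)) u k =
      (Fd (transition c d) (fst u) (fst k),
       Fd (\<lambda>z. Fd (transition c d) z (snd u)) (fst u) (fst k) + Fd (transition c d) (fst u) (snd k))"
proof -
  let ?W = "chart_dom c \<inter> chart_dom d" and ?C = "induced_chart A c" and ?D = "induced_chart A d"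
  have u: "fst u \<in> chart_map c ` ?W"
    using c d by (auto simp: u_def chart_map_induced_chart chart_dom_induced_chart)
  note der = has_derivative_tangent_map[OF open_chart_overlap smooth_transition, OF c(1) d(1) c(1) d(1) u]
  show "Fd (tangent_map (transition c d)) u k =
      (Fd (transition c d) (fst u) (fst k),
       Fd (\<lambda>z. Fd (transition c d) z (snd u)) (fst u) (fst k) + Fd (transition c d) (fst u) (snd k))"
    unfolding Fd_eqI[OF der] ..
  have "(transition ?C ?D has_derivative Fd (tangent_map (transition c d)) u) (at u within UNIV)"
  proof (rule has_derivative_transform_within_open[of "tangent_map (transition c d)" _ _ _ "chart_map c ` ?W \<times> UNIV"])
    show "(tangent_map (transition c d) has_derivative Fd (tangent_map (transition c d)) u) (at u)"
      using der unfolding Fd_eqI[OF der] .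
    show "open (chart_map c ` ?W \<times> (UNIV :: 'e set))"
      by (intro open_Times open_chart_overlap c d) auto
    show "u \<in> chart_map c ` ?W \<times> UNIV" using u by (auto simp: mem_Times_iff)
    fix u' assume "u' \<in> chart_map c ` ?W \<times> (UNIV :: 'e set)"
    then have "u' \<in> chart_map ?C ` {z \<in> chart_dom ?C. fst z \<in> ?W}"
      by (subst chart_map_induced_image[OF c(1)]) auto
    then obtain z' where z': "z' \<in> chart_dom ?C" "fst z' \<in> ?W" "u' = chart_map ?C z'"
      by blast
    then have "z' \<in> chart_dom ?D" by (simp add: chart_dom_induced_chart)
    then show "tangent_map (transition c d) u' = transition ?C ?D u'"
      using z' chart_map_eq_tangent_map[OF c(1) _ d(1)]
      by (simp add: transition_induced_chart_map[OF c(1)])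
  qed
  then show der': "(transition ?C ?D has_derivative Fd (tangent_map (transition c d)) u) (at u)"
    by simp
  show "Fd (transition ?C ?D) u = Fd (tangent_map (transition c d)) u"
    by (rule Fd_eqI[OF der'])
qed

text \<open>Needed for curves: a continuous curve stays in a chart domain for a short time.\<close>

lemma openin_chart_dom_induced:
  assumes "c \<in> A"
  shows "openin (atlas_topology (tangent_atlas A)) (chart_dom (induced_chart A c))"
  unfolding openin_atlas_topology
proof (intro conjI ballI)
  show "chart_dom (induced_chart A c) \<subseteq> carrier_of (tangent_atlas A)"
    using assms by (auto simp: carrier_of_def tangent_atlas_def)
  fix D assume "D \<in> tangent_atlas A"
  then obtain d where d: "d \<in> A" and D: "D = induced_chart A d"
    by (auto simp: tangent_atlas_def)
  have "{x \<in> chart_map D ` chart_dom D. chart_inv D x \<in> chart_dom (induced_chart A c)}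
      = chart_map D ` {z \<in> chart_dom D. fst z \<in> chart_dom d \<inter> chart_dom c}"
  proof -
    have "chart_inv D (chart_map D z) \<in> chart_dom (induced_chart A c) \<longleftrightarrow> fst z \<in> chart_dom d \<inter> chart_dom c"
      if "z \<in> chart_dom D" for z
      using that unfolding D by (simp add: chart_inv_induced_chart[OF d]) (simp add: chart_dom_induced_chart)
    then show ?thesis by blast
  qed
  also have "\<dots> = chart_map d ` (chart_dom d \<inter> chart_dom c) \<times> UNIV"
    unfolding D by (rule chart_map_induced_image[OF d]) auto
  finally show "open {x \<in> chart_map D ` chart_dom D. chart_inv D x \<in> chart_dom (induced_chart A c)}"
    using open_chart_overlap[OF d assms] by (simp add: open_Times)
qed

end

section \<open>The semisprays\<close>

lemma local_semispray_in_chart: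
  assumes "c \<in> A" "z \<in> chart_dom (induced_chart A c)"
  shows "local_semispray A H z (induced_chart A c) = (snd (chart_map (induced_chart A c) z),
    - H (induced_chart A c) (chart_map (induced_chart A c) z))"
  using assms by (simp add: local_semispray_def tangent_atlas_def)

lemma slit_image_eq:
  assumes "smooth_atlas A" "c \<in> A"
  shows "chart_map (induced_chart A c) ` (chart_dom (induced_chart A c) \<inter> slit_TM A)
    = chart_map c ` chart_dom c \<times> (- {0})"
proof -
  have "chart_dom (induced_chart A c) \<inter> slit_TM A
      = {z \<in> chart_dom (induced_chart A c) \<inter> slit_TM A. fst z \<in> chart_dom c}"
    by (auto simp: chart_dom_induced_chart)
  then show ?thesis
    using chart_map_induced_slit_image[OF assms, of "chart_dom c"] by simp
qed

lemma open_slit_image: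
  assumes "smooth_atlas A" "c \<in> A"
  shows "open (chart_map (induced_chart A c) ` (chart_dom (induced_chart A c) \<inter> slit_TM A))"
  unfolding slit_image_eq[OF assms]
  by (intro open_Times open_chart_map_image[OF assms]) auto

text \<open>The horizontal components \<open>y\<close> of a local semispray always transform as they should, because the
  horizontal part of the derivative of a tangent map is \<open>D\<phi>\<close>. Only the transformation of the
  vertical components is a condition on \<open>H\<close>.\<close>

lemma semispray_local_semispray:
  fixes A :: "('m, real ^ 'n::finite) chart set"
  assumes A: "smooth_atlas A"
    and smooth: "\<And>c. c \<in> A \<Longrightarrow>
      smooth_on (chart_map (induced_chart A c) ` (chart_dom (induced_chart A c) \<inter> slit_TM A))
        (H (induced_chart A c))"
    and compat: "\<And>c d z. c \<in> A \<Longrightarrow> d \<in> A \<Longrightarrow> z \<in> slit_TM A \<Longrightarrow>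
      z \<in> chart_dom (induced_chart A c) \<Longrightarrow> z \<in> chart_dom (induced_chart A d) \<Longrightarrow>
      - H (induced_chart A d) (chart_map (induced_chart A d) z) =
        snd (Fd (tangent_map (transition c d)) (chart_map (induced_chart A c) z)
          (snd (chart_map (induced_chart A c) z),
           - H (induced_chart A c) (chart_map (induced_chart A c) z)))"
  shows "semispray A (local_semispray A H)"
  unfolding semispray_def vector_field_on_def
proof (intro conjI ballI)
  fix z assume z: "z \<in> slit_TM A"
  show "local_semispray A H z \<in> tangent_space (tangent_atlas A) z"
    unfolding tangent_space_def mem_Collect_eq
  proof (intro conjI allI impI ballI)
    fix C assume "\<not> (C \<in> tangent_atlas A \<and> z \<in> chart_dom C)"
    then show "local_semispray A H z C = 0" by (auto simp: local_semispray_def)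
  next
    fix C D assume "C \<in> tangent_atlas A" "D \<in> tangent_atlas A" and zCD: "z \<in> chart_dom C \<inter> chart_dom D"
    then obtain c d where c: "c \<in> A" "C = induced_chart A c" and d: "d \<in> A" "D = induced_chart A d"
      by (auto simp: tangent_atlas_def)
    have zC: "z \<in> chart_dom (induced_chart A c)" and zD: "z \<in> chart_dom (induced_chart A d)"
      using zCD c d by auto
    note der = transition_induced_has_derivative[OF A c(1) zC d(1) zD]
    show "local_semispray A H z D
        = Fd (transition C D) (chart_map C z) (local_semispray A H z C)"
      unfolding c(2) d(2) local_semispray_in_chart[OF c(1) zC] local_semispray_in_chart[OF d(1) zD] der(2)
    proof (rule prod_eqI)
      show "fst (snd (chart_map (induced_chart A d) z), - H (induced_chart A d) (chart_map (induced_chart A d) z))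
        = fst (Fd (tangent_map (transition c d)) (chart_map (induced_chart A c) z)
          (snd (chart_map (induced_chart A c) z), - H (induced_chart A c) (chart_map (induced_chart A c) z)))"
        unfolding der(3) chart_map_eq_tangent_map[OF A c(1) zC d(1) zD] by (simp add: tangent_map_def)
    qed (simp only: snd_conv compat[OF c(1) d(1) z zC zD])
  qed
  show "tangent_structure (local_semispray A H z) = liouville A z"
    by (auto simp: tangent_structure_def local_semispray_def liouville_def fun_eq_iff zero_prod_def)
next
  fix C assume "C \<in> tangent_atlas A"
  then obtain c where c: "c \<in> A" "C = induced_chart A c" by (auto simp: tangent_atlas_def)
  let ?V = "chart_map C ` (chart_dom C \<inter> slit_TM A)"
  have V: "open ?V" using open_slit_image[OF A c(1)] c(2) by simp
  have sm: "smooth_on ?V (H C)" using smooth[OF c(1)] c(2) by simp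
  have "smooth_on ?V (\<lambda>u. (snd u, (- 1) *\<^sub>R H C u))"
    by (rule smooth_on_Pair[OF V smooth_on_linear[OF bounded_linear_snd] smooth_on_scaleR[OF V sm]])
  then show "smooth_on ?V (\<lambda>u. local_semispray A H (chart_inv C u) C)"
  proof (rule smooth_on_cong[OF V])
    fix u assume "u \<in> ?V"
    then obtain z where z: "z \<in> chart_dom (induced_chart A c)" "u = chart_map (induced_chart A c) z"
      using c by blast
    show "(snd u, (- 1) *\<^sub>R H C u) = local_semispray A H (chart_inv C u) C"
      by (simp add: z(2) c(2) chart_inv_induced_chart[OF A c(1) z(1)] local_semispray_in_chart[OF c(1) z(1)])
  qed
qed

context
  fixes A :: "('m, real ^ 'n::finite) chart set" and L :: "('m, real ^ 'n) tpoint \<Rightarrow> real"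
  assumes lagrange: "lagrange_space A L"
begin

lemma lagrange_space_atlas: "smooth_atlas A"
  using lagrange by (simp add: lagrange_space_def smooth_manifold_def)

lemma lagrangian_smooth:
  assumes "c \<in> A"
  shows "smooth_on (chart_map (induced_chart A c) ` (chart_dom (induced_chart A c) \<inter> slit_TM A))
    (L \<circ> chart_inv (induced_chart A c))"
  using lagrange assms unfolding lagrange_space_def smooth_fun_on_def tangent_atlas_def by blast

lemma metric_invertible:
  assumes "c \<in> A"
    and "u \<in> chart_map (induced_chart A c) ` (chart_dom (induced_chart A c) \<inter> slit_TM A)"
  shows "invertible (metric_matrix L (induced_chart A c) u)"
  using lagrange assms unfolding lagrange_space_def tangent_atlas_def by blast

text \<open>The coefficients in each chart are the unique zero of the Lagrange covector. By naturality the
  covector of the second chart for the transformed coefficients vanishes on the image of \<open>D\<phi>\<close>, which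
  is everything because \<open>D\<phi>\<close> has an inverse, the derivative of the reverse transition map.\<close>

lemma two_G0_change_of_chart:
  assumes c: "c \<in> A" "z \<in> chart_dom (induced_chart A c)"
    and d: "d \<in> A" "z \<in> chart_dom (induced_chart A d)" and z: "z \<in> slit_TM A"
  shows "- two_G0 L (induced_chart A d) (chart_map (induced_chart A d) z) =
    snd (Fd (tangent_map (transition c d)) (chart_map (induced_chart A c) z)
      (snd (chart_map (induced_chart A c) z),
       - two_G0 L (induced_chart A c) (chart_map (induced_chart A c) z)))"
proof -
  let ?C = "induced_chart A c" and ?D = "induced_chart A d" and ?T = "tangent_map (transition c d)"
  let ?VC = "chart_map ?C ` (chart_dom ?C \<inter> slit_TM A)"
  let ?VD = "chart_map ?D ` (chart_dom ?D \<inter> slit_TM A)"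
  let ?dom = "chart_dom c \<inter> chart_dom d"
  let ?W = "chart_map ?C ` {z \<in> chart_dom ?C \<inter> slit_TM A. fst z \<in> ?dom}"
  define u where "u = chart_map ?C z"
  define b where "b = - two_G0 L ?C u"
  note A = lagrange_space_atlas
  note VC = open_slit_image[OF A c(1)] and VD = open_slit_image[OF A d(1)]
  have p: "fst z \<in> chart_dom c" "fst z \<in> chart_dom d"
    using c d by (simp_all add: chart_dom_induced_chart)
  have uVC: "u \<in> ?VC" unfolding u_def using c z by blast
  have Tu: "?T u = chart_map ?D z"
    unfolding u_def by (rule chart_map_eq_tangent_map[OF A c d, symmetric])
  have uVD: "?T u \<in> ?VD" unfolding Tu using d z by blast
  have W: "open ?W"
    unfolding chart_map_induced_slit_image[OF A c(1) Int_lower1]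
    by (intro open_Times open_chart_overlap[OF A c(1) d(1)]) auto
  have in_W: "fst u' \<in> chart_map c ` ?dom \<and> ?T u' \<in> ?VD \<and>
      (L \<circ> chart_inv ?C) u' = (L \<circ> chart_inv ?D) (?T u')" if "u' \<in> ?W" for u'
  proof -
    from that obtain z' where z': "z' \<in> chart_dom ?C" "z' \<in> slit_TM A" "fst z' \<in> ?dom"
      and u': "u' = chart_map ?C z'" by blast
    have zD: "z' \<in> chart_dom ?D" using z' by (simp add: chart_dom_induced_chart)
    have "?T u' = chart_map ?D z'"
      unfolding u' by (rule chart_map_eq_tangent_map[OF A c(1) z'(1) d(1) zD, symmetric])
    then show ?thesis
      using z' zD
      by (simp add: u' chart_inv_induced_chart[OF A c(1) z'(1)] chart_inv_induced_chart[OF A d(1) zD])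
        (auto simp: chart_map_induced_chart)
  qed
  have natural: "lagrange_covector (L \<circ> chart_inv ?C) u b w =
      lagrange_covector (L \<circ> chart_inv ?D) (?T u) (snd (Fd ?T u (snd u, b))) (Fd (transition c d) (fst u) w)" for w
  proof (rule lagrange_covector_natural[OF open_chart_overlap[OF A c(1) d(1)] smooth_transition[OF A c(1) d(1)]
        VD lagrangian_smooth[OF d(1)] W])
    show "u \<in> ?W" unfolding u_def using c z p by blast
  qed (use in_W in blast)+
  have "lagrange_covector (L \<circ> chart_inv ?D) (?T u) (snd (Fd ?T u (snd u, b))) w = 0" for w
  proof -
    have u1: "fst u = chart_map c (fst z)" by (simp add: u_def chart_map_induced_chart)
    have "Fd (transition c d) (fst u) (Fd (transition d c) (chart_map d (fst z)) w) = w"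
      unfolding u1 using Fd_transition_compose[OF A d(1) p(2) c(1) p(1) d(1) p(2)]
        Fd_transition_self[OF A d(1) p(2)] by simp
    then have "lagrange_covector (L \<circ> chart_inv ?D) (?T u) (snd (Fd ?T u (snd u, b))) w
        = lagrange_covector (L \<circ> chart_inv ?C) u b (Fd (transition d c) (chart_map d (fst z)) w)"
      using natural by simp
    also have "\<dots> = 0"
      using lagrange_covector_eq_0_iff[OF VC lagrangian_smooth[OF c(1)] uVC metric_invertible[OF c(1) uVC], of b] b_def
      by blast
    finally show ?thesis .
  qed
  then have "snd (Fd ?T u (snd u, b)) = - two_G0 L ?D (?T u)"
    using lagrange_covector_eq_0_iff[OF VD lagrangian_smooth[OF d(1)] uVD metric_invertible[OF d(1) uVD]]
    by blast
  then show ?thesis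
    by (simp add: u_def b_def Tu[unfolded u_def])
qed

lemma two_G0_smooth_slit:
  assumes "c \<in> A"
  shows "smooth_on (chart_map (induced_chart A c) ` (chart_dom (induced_chart A c) \<inter> slit_TM A))
    (two_G0 L (induced_chart A c))"
  by (rule two_G0_smooth[OF open_slit_image[OF lagrange_space_atlas assms] lagrangian_smooth[OF assms]
        metric_invertible[OF assms]])

lemma semispray_canonical: "semispray A (canonical_semispray A L)"
  unfolding canonical_semispray_def
  by (rule semispray_local_semispray[OF lagrange_space_atlas two_G0_smooth_slit two_G0_change_of_chart])

end

lemma slit_TM_subset: "slit_TM A \<subseteq> TM A"
  by (auto simp: slit_TM_def)

context
  fixes A :: "('m, real ^ 'n::finite) chart set" and Fe :: "('m, real ^ 'n) tfield"
  assumes A: "smooth_atlas A" and Fe: "vertical_field A Fe"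
begin

lemma force_field_tangent: "z \<in> TM A \<Longrightarrow> Fe z \<in> tangent_space (tangent_atlas A) z"
  using Fe by (simp add: vertical_field_def vector_field_on_def)

lemma force_field_in_chart:
  assumes "c \<in> A" "z \<in> chart_dom (induced_chart A c)"
  shows "Fe z (induced_chart A c) = (0, force Fe (induced_chart A c) (chart_map (induced_chart A c) z))"
proof -
  have "fst (Fe z (induced_chart A c)) = 0"
    using Fe assms by (simp add: vertical_field_def tangent_atlas_def)
  then show ?thesis
    by (simp add: force_def chart_inv_induced_chart[OF A assms] prod_eq_iff)
qed

lemma force_smooth_slit:
  assumes "c \<in> A"
  shows "smooth_on (chart_map (induced_chart A c) ` (chart_dom (induced_chart A c) \<inter> slit_TM A))
    (force Fe (induced_chart A c))"
proof -
  let ?C = "induced_chart A c"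
  have "smooth_on (chart_map ?C ` (chart_dom ?C \<inter> TM A)) (\<lambda>x. Fe (chart_inv ?C x) ?C)"
    using Fe assms by (simp add: vertical_field_def vector_field_on_def tangent_atlas_def)
  then have "smooth_on (chart_map ?C ` (chart_dom ?C \<inter> slit_TM A)) (\<lambda>x. Fe (chart_inv ?C x) ?C)"
    by (rule smooth_on_subset) (use slit_TM_subset in blast)
  from smooth_on_bounded_linear[OF bounded_linear_snd open_slit_image[OF A assms] this]
  show ?thesis by (simp add: force_def[abs_def])
qed

text \<open>A vertical vector stays vertical, and its components transform by the derivative of the tangent
  map.\<close>

lemma force_change_of_chart:
  assumes c: "c \<in> A" "z \<in> chart_dom (induced_chart A c)"
    and d: "d \<in> A" "z \<in> chart_dom (induced_chart A d)" and z: "z \<in> slit_TM A"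
  shows "(0, force Fe (induced_chart A d) (chart_map (induced_chart A d) z)) =
    Fd (tangent_map (transition c d)) (chart_map (induced_chart A c) z)
      (0, force Fe (induced_chart A c) (chart_map (induced_chart A c) z))"
proof -
  let ?C = "induced_chart A c" and ?D = "induced_chart A d"
  have "Fe z ?D = Fd (transition ?C ?D) (chart_map ?C z) (Fe z ?C)"
    using c d z slit_TM_subset
    by (intro tangent_space_change_chart[OF force_field_tangent]) (auto simp: tangent_atlas_def)
  then show ?thesis
    unfolding transition_induced_has_derivative(2)[OF A c d]
      force_field_in_chart[OF c] force_field_in_chart[OF d] .
qed

lemma mechanical_semispray_eq:
  assumes z: "z \<in> slit_TM A"
  shows "mechanical_semispray A L Fe z = (\<lambda>C. canonical_semispray A L z C + (1/2) *\<^sub>R Fe z C)"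
proof
  fix C
  show "mechanical_semispray A L Fe z C = canonical_semispray A L z C + (1/2) *\<^sub>R Fe z C"
  proof (cases "C \<in> tangent_atlas A \<and> z \<in> chart_dom C")
    case True
    then obtain c where c: "c \<in> A" "z \<in> chart_dom (induced_chart A c)" and C: "C = induced_chart A c"
      by (auto simp: tangent_atlas_def)
    show ?thesis
      unfolding C mechanical_semispray_def canonical_semispray_def
        local_semispray_in_chart[OF c] force_field_in_chart[OF c]
      by (simp add: two_G_def)
  next
    case False
    have "Fe z C = 0"
      using tangent_space_off_chart[OF force_field_tangent False] z slit_TM_subset by blast
    then show ?thesis
      using False by (auto simp: mechanical_semispray_def canonical_semispray_def local_semispray_def)
  qed
qed

end

text \<open>The derivative of the tangent map is linear, so the transformation laws of the canonical
  coefficients and of the force add up.\<close>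

lemma semispray_mechanical:
  assumes lagrange: "lagrange_space A L" and Fe: "vertical_field A Fe"
  shows "semispray A (mechanical_semispray A L Fe)"
  unfolding mechanical_semispray_def
proof (rule semispray_local_semispray[OF lagrange_space_atlas[OF lagrange]])
  fix c assume c: "c \<in> A"
  note V = open_slit_image[OF lagrange_space_atlas[OF lagrange] c]
  show "smooth_on (chart_map (induced_chart A c) ` (chart_dom (induced_chart A c) \<inter> slit_TM A))
      (two_G L Fe (induced_chart A c))"
    unfolding two_G_def[abs_def]
    by (intro smooth_on_diff[OF V] two_G0_smooth_slit[OF lagrange c] smooth_on_scaleR[OF V] force_smooth_slit[OF lagrange_space_atlas[OF lagrange] Fe c])
next
  fix c d z
  assume c: "c \<in> A" and d: "d \<in> A" and z: "z \<in> slit_TM A"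
    and zC: "z \<in> chart_dom (induced_chart A c)" and zD: "z \<in> chart_dom (induced_chart A d)"
  let ?C = "induced_chart A c" and ?D = "induced_chart A d"
  let ?P = "Fd (tangent_map (transition c d)) (chart_map ?C z)"
  have lin: "linear ?P"
    using transition_induced_has_derivative(1)[OF lagrange_space_atlas[OF lagrange] c zC d zD]
    by (rule has_derivative_linear)
  have "?P (snd (chart_map ?C z), - two_G L Fe ?C (chart_map ?C z))
      = ?P ((snd (chart_map ?C z), - two_G0 L ?C (chart_map ?C z))
          + (1/2) *\<^sub>R (0, force Fe ?C (chart_map ?C z)))"
    by (simp add: two_G_def)
  also have "\<dots> = ?P (snd (chart_map ?C z), - two_G0 L ?C (chart_map ?C z))
      + (1/2) *\<^sub>R ?P (0, force Fe ?C (chart_map ?C z))"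
    by (simp only: linear_add[OF lin] linear_cmul[OF lin])
  finally have "snd (?P (snd (chart_map ?C z), - two_G L Fe ?C (chart_map ?C z)))
      = - two_G0 L ?D (chart_map ?D z) + (1/2) *\<^sub>R force Fe ?D (chart_map ?D z)"
    by (simp only: snd_add snd_scaleR snd_conv two_G0_change_of_chart[OF lagrange c zC d zD z]
        force_change_of_chart[OF lagrange_space_atlas[OF lagrange] Fe c zC d zD z, symmetric])
  then show "- two_G L Fe ?D (chart_map ?D z)
      = snd (?P (snd (chart_map ?C z), - two_G L Fe ?C (chart_map ?C z)))"
    by (simp add: two_G_def)
qed

section \<open>Curves\<close>

lemma has_vector_derivative_prod_iff:
  "(u has_vector_derivative (a, b)) (at t) \<longleftrightarrow>
    ((\<lambda>s. fst (u s)) has_vector_derivative a) (at t) \<and> ((\<lambda>s. snd (u s)) has_vector_derivative b) (at t)"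
proof
  assume u: "(u has_vector_derivative (a, b)) (at t)"
  show "((\<lambda>s. fst (u s)) has_vector_derivative a) (at t) \<and> ((\<lambda>s. snd (u s)) has_vector_derivative b) (at t)"
    using bounded_linear.has_vector_derivative[OF bounded_linear_fst u]
      bounded_linear.has_vector_derivative[OF bounded_linear_snd u] by simp
next
  assume "((\<lambda>s. fst (u s)) has_vector_derivative a) (at t) \<and> ((\<lambda>s. snd (u s)) has_vector_derivative b) (at t)"
  then show "(u has_vector_derivative (a, b)) (at t)"
    using has_derivative_Pair[of "\<lambda>s. fst (u s)" "\<lambda>h. h *\<^sub>R a" t UNIV "\<lambda>s. snd (u s)" "\<lambda>h. h *\<^sub>R b"]
    by (simp add: has_vector_derivative_def)
qed

text \<open>The chain rule. The velocity \<open>(y, b)\<close> of the curve in \<open>TM\<close> is the direction in which the covector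
  differentiates \<open>\<partial>f/\<partial>y\<close>.\<close>

lemma lagrange_covector_along_curve:
  assumes f: "smooth_on V f" and V: "u t \<in> V"
    and u: "(u has_vector_derivative (snd (u t), b)) (at t)"
  shows "deriv (\<lambda>s. partial_y i f (u s)) t - partial_x i f (u t) = lagrange_covector f (u t) b (axis i 1)"
proof -
  let ?P = "Fd (\<lambda>u'. Fd f u' (0, axis i 1)) (u t)"
  have "((\<lambda>s. partial_y i f (u s)) has_derivative (\<lambda>h. ?P (h *\<^sub>R (snd (u t), b)))) (at t)"
    unfolding partial_y_def
    by (rule has_derivative_compose[OF u[unfolded has_vector_derivative_def]
          smooth_on_has_derivative[OF smooth_on_Fd[OF f] V]])
  then have "((\<lambda>s. partial_y i f (u s)) has_field_derivative ?P (snd (u t), b)) (at t)"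
    by (simp only: linear_cmul[OF linear_Fd[OF smooth_on_Fd[OF f] V]] has_field_derivative_def
        real_scaleR_def mult_commute_abs)
  then show ?thesis
    by (simp add: DERIV_imp_deriv lagrange_covector_def partial_x_def)
qed

text \<open>At a single time, the Lagrange equations determine the acceleration, because \<open>g\<close> is nonsingular.
  Conversely an integral curve has a differentiable velocity \<open>y\<close>, as its vertical component.\<close>

lemma lagrange_equations_iff:
  fixes u :: "real \<Rightarrow> 'n::finite xy"
  assumes V: "open V" and f: "smooth_on V (L \<circ> chart_inv C)" and ut: "u t \<in> V"
    and inv: "invertible (metric_matrix L C (u t))"
  shows "((\<lambda>s. fst (u s)) has_vector_derivative snd (u t)) (at t) \<and>
      (\<lambda>s. snd (u s)) differentiable (at t) \<and>
      (\<forall>i. deriv (\<lambda>s. partial_y i (L \<circ> chart_inv C) (u s)) t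
         - partial_x i (L \<circ> chart_inv C) (u t) = lower_force L Fe C (u t) $ i)
    \<longleftrightarrow> (u has_vector_derivative (snd (u t), - two_G L Fe C (u t))) (at t)"
    (is "?x \<and> ?y \<and> ?eq \<longleftrightarrow> ?int")
proof -
  have eq_iff: "?eq \<longleftrightarrow> b = - two_G L Fe C (u t)"
    if "(u has_vector_derivative (snd (u t), b)) (at t)" for b
    using lagrange_covector_along_curve[OF f ut that]
      lagrange_covector_eq_lower_force_iff[OF V f ut inv, of b Fe] by simp
  show ?thesis
  proof
    assume lag: "?x \<and> ?y \<and> ?eq"
    then obtain b where "((\<lambda>s. snd (u s)) has_vector_derivative b) (at t)"
      using vector_derivative_works by blast
    with lag have "(u has_vector_derivative (snd (u t), b)) (at t)"
      by (simp add: has_vector_derivative_prod_iff)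
    with eq_iff lag show ?int by blast
  next
    assume int: "?int"
    then show "?x \<and> ?y \<and> ?eq"
      using eq_iff[OF int] unfolding has_vector_derivative_prod_iff
      by (auto intro: differentiableI_vector)
  qed
qed

text \<open>On an open set of times where \<open>x\<close> has derivative \<open>y\<close>, the function \<open>y\<close> may be replaced by the
  derivative of \<open>x\<close>, also when it is differentiated once more. At a single time this fails, which is
  why the equivalence is about all times in an open set.\<close>

lemma second_order_iff:
  fixes u :: "real \<Rightarrow> 'n::finite xy"
  assumes T: "open T"
  shows "(\<forall>t\<in>T. ((\<lambda>s. fst (u s)) has_vector_derivative snd (u t)) (at t) \<and>
      (\<exists>a. ((\<lambda>s. vector_derivative (\<lambda>s. fst (u s)) (at s)) has_vector_derivative a) (at t) \<and>
        a + two_G0 L C (fst (u t), vector_derivative (\<lambda>s. fst (u s)) (at t))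
          = (1/2) *\<^sub>R force Fe C (fst (u t), vector_derivative (\<lambda>s. fst (u s)) (at t))))
    \<longleftrightarrow> (\<forall>t\<in>T. (u has_vector_derivative (snd (u t), - two_G L Fe C (u t))) (at t))"
    (is "(\<forall>t\<in>T. ?x t \<and> ?sec t) \<longleftrightarrow> (\<forall>t\<in>T. ?int t)")
proof -
  let ?v = "\<lambda>s. vector_derivative (\<lambda>s. fst (u s)) (at s)"
  have "(\<exists>a. (?v has_vector_derivative a) (at t) \<and> a + two_G0 L C (fst (u t), ?v t)
        = (1/2) *\<^sub>R force Fe C (fst (u t), ?v t))
      \<longleftrightarrow> ((\<lambda>s. snd (u s)) has_vector_derivative - two_G L Fe C (u t)) (at t)"
    if x: "\<forall>t\<in>T. ?x t" and t: "t \<in> T" for t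
  proof -
    have v: "?v s = snd (u s)" if "s \<in> T" for s
      using x that by (simp add: vector_derivative_at)
    have "(?v has_vector_derivative a) (at t) \<longleftrightarrow> ((\<lambda>s. snd (u s)) has_vector_derivative a) (at t)" for a
      using has_vector_derivative_transform_within_open[OF _ T t, of ?v a "\<lambda>s. snd (u s)"]
        has_vector_derivative_transform_within_open[OF _ T t, of "\<lambda>s. snd (u s)" a ?v] v by auto
    moreover have "a + two_G0 L C (fst (u t), ?v t) = (1/2) *\<^sub>R force Fe C (fst (u t), ?v t)
        \<longleftrightarrow> a = - two_G L Fe C (u t)" for a
      by (auto simp: v[OF t] two_G_def algebra_simps)
    ultimately show ?thesis by simp
  qed
  then show ?thesis
    unfolding has_vector_derivative_prod_iff by blast
qed

lemma curve_in_chart_open: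
  fixes I :: "real set"
  assumes A: "smooth_atlas A" and c: "c \<in> A" and I: "open I"
    and \<gamma>: "curve_in (tangent_atlas A) W I \<gamma>"
  shows "open {t \<in> I. \<gamma> t \<in> chart_dom (induced_chart A c)}"
proof -
  have "openin (top_of_set I) {t \<in> topspace (top_of_set I). \<gamma> t \<in> chart_dom (induced_chart A c)}"
    using \<gamma> openin_chart_dom_induced[OF A c] unfolding curve_in_def
    by (intro openin_continuous_map_preimage) auto
  then show ?thesis
    using I by (simp add: openin_open_eq)
qed

theorem theorem3p3p1:
  fixes A :: "('m, real ^ 'n::finite) chart set"
    and L :: "('m, real ^ 'n) tpoint \<Rightarrow> real"
    and Fe :: "('m, real ^ 'n) tfield"
  assumes "lagrangian_mechanical_system A L Fe"
  shows "(semispray A (canonical_semispray A L) \<and>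
          (\<forall>z\<in>slit_TM A. mechanical_semispray A L Fe z =
             (\<lambda>C. canonical_semispray A L z C + (1/2) *\<^sub>R Fe z C))) \<and>
         semispray A (mechanical_semispray A L Fe) \<and>
         (\<forall>I \<gamma>. open I \<and> is_interval I \<longrightarrow>
            (integral_curve (tangent_atlas A) (slit_TM A) (mechanical_semispray A L Fe) I \<gamma> \<longleftrightarrow>
               evolution_curve A L Fe I \<gamma>) \<and>
            (evolution_curve A L Fe I \<gamma> \<longleftrightarrow> second_order_solution A L Fe I \<gamma>))"
proof -
  have lagrange: "lagrange_space A L" and Fe: "vertical_field A Fe"
    using assms by (simp_all add: lagrangian_mechanical_system_def)
  note A = lagrange_space_atlas[OF lagrange]
  let ?S = "mechanical_semispray A L Fe"
  have "(integral_curve (tangent_atlas A) (slit_TM A) ?S I \<gamma> \<longleftrightarrow> evolution_curve A L Fe I \<gamma>) \<and>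
      (evolution_curve A L Fe I \<gamma> \<longleftrightarrow> second_order_solution A L Fe I \<gamma>)"
    if I: "open I" for I \<gamma>
  \<comment> \<open>All three notions of a solution are brought into the same form: the equation of an integral curve in every induced chart.\<close>
  proof (cases "curve_in (tangent_atlas A) (slit_TM A) I \<gamma>")
    case False
    then show ?thesis
      by (simp add: integral_curve_def evolution_curve_def second_order_solution_def)
  next
    case True
    have slit: "\<gamma> t \<in> slit_TM A" if "t \<in> I" for t
      using True that by (simp add: curve_in_def)
    let ?u = "\<lambda>C s. chart_map C (\<gamma> s)"
    let ?eq = "\<lambda>C t. (?u C has_vector_derivative (snd (?u C t), - two_G L Fe C (?u C t))) (at t)"
    let ?all = "\<lambda>P. \<forall>C\<in>tangent_atlas A. \<forall>t\<in>I. \<gamma> t \<in> chart_dom C \<longrightarrow> P C t"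
    have "integral_curve (tangent_atlas A) (slit_TM A) ?S I \<gamma> \<longleftrightarrow> ?all ?eq"
      using True by (simp add: integral_curve_def mechanical_semispray_def local_semispray_def)
    moreover have "evolution_curve A L Fe I \<gamma> \<longleftrightarrow> ?all ?eq"
    proof -
      have "(((\<lambda>s. fst (?u C s)) has_vector_derivative snd (?u C t)) (at t) \<and>
          (\<lambda>s. snd (?u C s)) differentiable (at t) \<and>
          (\<forall>i. deriv (\<lambda>s. partial_y i (L \<circ> chart_inv C) (?u C s)) t
             - partial_x i (L \<circ> chart_inv C) (?u C t) = lower_force L Fe C (?u C t) $ i)) \<longleftrightarrow> ?eq C t"
        if C: "C \<in> tangent_atlas A" and t: "t \<in> I" "\<gamma> t \<in> chart_dom C" for C t
      proof -
        obtain c where c: "c \<in> A" "C = induced_chart A c" using C by (auto simp: tangent_atlas_def)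
        have ut: "?u C t \<in> chart_map (induced_chart A c) ` (chart_dom (induced_chart A c) \<inter> slit_TM A)"
          using t slit c by blast
        show ?thesis
          unfolding c(2)
          by (rule lagrange_equations_iff[where u = "?u (induced_chart A c)" and t = t, OF open_slit_image[OF A c(1)] lagrangian_smooth[OF lagrange c(1)]
                ut[unfolded c(2)] metric_invertible[OF lagrange c(1) ut[unfolded c(2)]]])
      qed
      then show ?thesis
        using True by (simp add: evolution_curve_def Let_def)
    qed
    moreover have "second_order_solution A L Fe I \<gamma> \<longleftrightarrow> ?all ?eq"
    proof -
      let ?v = "\<lambda>C s. vector_derivative (\<lambda>s. fst (?u C s)) (at s)"
      have "(\<forall>t\<in>I. \<gamma> t \<in> chart_dom C \<longrightarrow>
            ((\<lambda>s. fst (?u C s)) has_vector_derivative snd (?u C t)) (at t) \<and>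
            (\<exists>a. (?v C has_vector_derivative a) (at t) \<and>
              a + two_G0 L C (fst (?u C t), ?v C t) = (1/2) *\<^sub>R force Fe C (fst (?u C t), ?v C t)))
          \<longleftrightarrow> (\<forall>t\<in>I. \<gamma> t \<in> chart_dom C \<longrightarrow> ?eq C t)"
        if "C \<in> tangent_atlas A" for C
      proof -
        have "open {t \<in> I. \<gamma> t \<in> chart_dom C}"
          using that curve_in_chart_open[OF A _ I True] by (auto simp: tangent_atlas_def)
        from second_order_iff[OF this, of "?u C" L C Fe] show ?thesis
          unfolding Ball_def mem_Collect_eq imp_conjL .
      qed
      then show ?thesis
        using True unfolding second_order_solution_def Let_def by simp
    qed
    ultimately show ?thesis by blast
  qed
  then show ?thesis
    using semispray_canonical[OF lagrange] mechanical_semispray_eq[OF A Fe]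
      semispray_mechanical[OF lagrange Fe]
    by blast
qed

end
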